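(* Let $n\ge 9$ be odd, and set $k=\lfloor n/2\rfloor$. For $Y=(y_{i,j})\in\mathbb R^{[k]\times[k]}$ write $R_{i,j}(Y)=\sum_{j'=1}^{j}y_{i,j'}$ and $K_{i,j}(Y)=\sum_{i'=1}^{i}y_{i',j}$. The facets of $P^{\mathrm{core}}_{\mathrm{VHSASM}}$ are exactly the following faces of $P^{\mathrm{core}}_{\mathrm{VHSASM}}$, one for each listed equation: (a) the faces $\{R_{i,j}(Y)=0\}$ for $(i,j)\in\{(2,2)\}\cup\{(i,j): i\in[3,k-1],\ j\in[2,k-1-\chi_{2\mid i}]\}\cup\bigl(\{k\}\times\{j\in[3,k-1]: 2\nmid j\}\bigr)$; (b) the faces $\{R_{i,j}(Y)=1\}$ for $(i,j)\in\{(i,j): i\in[4,k-1],\ j\in[4,k-1-\chi_{2\nmid i}]\}\cup\bigl(\{k\}\times\{j\in[4,k-1]: 2\mid j\}\bigr)$; (c) the faces $\{K_{i,j}(Y)=0\}$ for $(i,j)\in\{(i,j): j\in[3,k-1],\ i\in[2,k-1-\chi_{2\mid j}]\}\cup\bigl(\{i\in[3,k-2]: 2\nmid i\}\times\{k\}\bigr)$; (d) the faces $\{K_{i,j}(Y)=1\}$ for $(i,j)\in\{(i,j): j\in[4,k-1],\ i\in[4,k-1-\chi_{2\nmid j}]\}\cup\bigl(\{i\in[4,k-2]: 2\mid i\}\times\{k\}\bigr)$. In particular, the number of facets of $P^{\mathrm{core}}_{\mathrm{VHSASM}}$ is $n^2-15n+60$.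
   Context: $[a,b]=\{a,a+1,\dots,b\}$ for integers $a\le b$, $[a,b]=\emptyset$ if $a>b$, and $[n]=[1,n]$. $\chi_{\mathcal P}$ equals $1$ if the predicate $\mathcal P$ holds and $0$ otherwise. An $n\times n$ alternating sign matrix (ASM) is an $n\times n$ matrix with entries in $\{0,1,-1\}$ such that in each row and each column the non-zero entries alternate in sign and the first and last non-zero entries are $1$ (so every row and column sums to $1$). A VHSASM is an $n\times n$ ASM $X$ with $x_{i,j}=x_{i,n+1-j}=x_{n+1-i,j}$ for all $i,j\in[n]$. For odd $n$ and $k=\lfloor n/2\rfloor$, the core of a VHSASM $X$ is its upper-left $k\times k$ block $(x_{i,j})_{(i,j)\in[k]\times[k]}\in\mathbb R^{[k]\times[k]}$, and $P^{\mathrm{core}}_{\mathrm{VHSASM}}\subseteq\mathbb R^{[k]\times[k]}$ is the convex hull of the cores of all $n\times n$ VHSASMs. A facet of a polytope $P$ is a face of dimension $\dim P-1$; by "the face $\{L(Y)=c\}$" we mean $\{Y\in P^{\mathrm{core}}_{\mathrm{VHSASM}}: L(Y)=c\}$. *)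

theory Defs
  imports "HOL-Analysis.Analysis"
begin

text \<open>
  An n \<open>\<times>\<close> n matrix is a function \<^typ>\<open>nat \<Rightarrow> nat \<Rightarrow> real\<close> of which only the entries with indices
  in \<open>{1..n}\<close> matter.  The space of k \<open>\<times>\<close> k matrices, in which the polytope lives, has to be a
  Euclidean space, so it is rendered as \<^typ>\<open>real ^ 'k ^ 'k\<close>; a bijection \<open>idx\<close> from \<open>{1..k}\<close>
  to the finite type \<^typ>\<open>'k\<close> numbers rows and columns.
\<close>

text \<open>The third conjunct picks out the first, the fourth the last non-zero entry; the fifth
  says that consecutive non-zero entries have opposite signs.\<close>

definition alternating_line :: "nat \<Rightarrow> (nat \<Rightarrow> real) \<Rightarrow> bool" where
  "alternating_line n v \<longleftrightarrow>
     (\<forall>p\<in>{1..n}. v p \<in> {0, 1, -1}) \<and>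
     (\<exists>p\<in>{1..n}. v p \<noteq> 0) \<and>
     (\<forall>p\<in>{1..n}. v p \<noteq> 0 \<and> (\<forall>q\<in>{1..<p}. v q = 0) \<longrightarrow> v p = 1) \<and>
     (\<forall>p\<in>{1..n}. v p \<noteq> 0 \<and> (\<forall>q\<in>{p<..n}. v q = 0) \<longrightarrow> v p = 1) \<and>
     (\<forall>p\<in>{1..n}. \<forall>q\<in>{p<..n}. v p \<noteq> 0 \<and> v q \<noteq> 0 \<and> (\<forall>r\<in>{p<..<q}. v r = 0)
        \<longrightarrow> sgn (v q) = - sgn (v p))"

definition is_asm :: "nat \<Rightarrow> (nat \<Rightarrow> nat \<Rightarrow> real) \<Rightarrow> bool" where
  "is_asm n X \<longleftrightarrow>
     (\<forall>i\<in>{1..n}. alternating_line n (\<lambda>j. X i j)) \<and>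
     (\<forall>j\<in>{1..n}. alternating_line n (\<lambda>i. X i j))"

definition is_vhsasm :: "nat \<Rightarrow> (nat \<Rightarrow> nat \<Rightarrow> real) \<Rightarrow> bool" where
  "is_vhsasm n X \<longleftrightarrow> is_asm n X \<and>
     (\<forall>i\<in>{1..n}. \<forall>j\<in>{1..n}. X i j = X i (n + 1 - j) \<and> X i j = X (n + 1 - i) j)"

definition core :: "(nat \<Rightarrow> 'k::finite) \<Rightarrow> nat \<Rightarrow> (nat \<Rightarrow> nat \<Rightarrow> real) \<Rightarrow> real ^ 'k ^ 'k" where
  "core idx n X =
     (\<chi> a b. X (inv_into {1..n div 2} idx a) (inv_into {1..n div 2} idx b))"

definition core_polytope :: "(nat \<Rightarrow> 'k::finite) \<Rightarrow> nat \<Rightarrow> (real ^ 'k ^ 'k) set" where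
  "core_polytope idx n = convex hull {core idx n X | X. is_vhsasm n X}"

definition row_sum :: "(nat \<Rightarrow> 'k::finite) \<Rightarrow> nat \<Rightarrow> nat \<Rightarrow> real ^ 'k ^ 'k \<Rightarrow> real" where
  "row_sum idx i j Y = (\<Sum>j'=1..j. Y $ idx i $ idx j')"

definition col_sum :: "(nat \<Rightarrow> 'k::finite) \<Rightarrow> nat \<Rightarrow> nat \<Rightarrow> real ^ 'k ^ 'k \<Rightarrow> real" where
  "col_sum idx i j Y = (\<Sum>i'=1..i. Y $ idx i' $ idx j)"

text \<open>\<open>Row_Eq i j c\<close> and \<open>Col_Eq i j c\<close> stand for the equations \<open>row_sum idx i j Y = c\<close>
  and \<open>col_sum idx i j Y = c\<close>.  Keeping them syntactic makes it possible to say that different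
  equations give different faces.\<close>

datatype equation = Row_Eq nat nat real | Col_Eq nat nat real

fun satisfies :: "(nat \<Rightarrow> 'k::finite) \<Rightarrow> real ^ 'k ^ 'k \<Rightarrow> equation \<Rightarrow> bool" where
  "satisfies idx Y (Row_Eq i j c) \<longleftrightarrow> row_sum idx i j Y = c"
| "satisfies idx Y (Col_Eq i j c) \<longleftrightarrow> col_sum idx i j Y = c"

definition core_face :: "(nat \<Rightarrow> 'k::finite) \<Rightarrow> nat \<Rightarrow> equation \<Rightarrow> (real ^ 'k ^ 'k) set" where
  "core_face idx n e = {Y \<in> core_polytope idx n. satisfies idx Y e}"

definition row_zero_indices :: "nat \<Rightarrow> (nat \<times> nat) set" where
  "row_zero_indices k =
     {(2, 2)} \<union>
     {(i, j). i \<in> {3..k - 1} \<and> j \<in> {2..k - 1 - of_bool (even i)}} \<union>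
     {k} \<times> {j \<in> {3..k - 1}. odd j}"

definition row_one_indices :: "nat \<Rightarrow> (nat \<times> nat) set" where
  "row_one_indices k =
     {(i, j). i \<in> {4..k - 1} \<and> j \<in> {4..k - 1 - of_bool (odd i)}} \<union>
     {k} \<times> {j \<in> {4..k - 1}. even j}"

definition col_zero_indices :: "nat \<Rightarrow> (nat \<times> nat) set" where
  "col_zero_indices k =
     {(i, j). j \<in> {3..k - 1} \<and> i \<in> {2..k - 1 - of_bool (even j)}} \<union>
     {i \<in> {3..k - 2}. odd i} \<times> {k}"

definition col_one_indices :: "nat \<Rightarrow> (nat \<times> nat) set" where
  "col_one_indices k =
     {(i, j). j \<in> {4..k - 1} \<and> i \<in> {4..k - 1 - of_bool (odd j)}} \<union>
     {i \<in> {4..k - 2}. even i} \<times> {k}"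

definition facet_equations :: "nat \<Rightarrow> equation set" where
  "facet_equations k =
     {Row_Eq i j 0 | i j. (i, j) \<in> row_zero_indices k} \<union>
     {Row_Eq i j 1 | i j. (i, j) \<in> row_one_indices k} \<union>
     {Col_Eq i j 0 | i j. (i, j) \<in> col_zero_indices k} \<union>
     {Col_Eq i j 1 | i j. (i, j) \<in> col_one_indices k}"

end

theory Submission
  imports Defs
begin

text \<open>
  In terms of the corner sums \<open>h i j\<close> of the core, the symmetry of the matrix forces the
  values of \<open>h\<close> on the boundary of \<open>{0..k} \<times> {0..k}\<close>, and the remaining conditions say that \<open>h\<close>
  increases by 0 or 1 in each step.  A system of difference constraints with integral bounds
  describes an integral polytope: if \<open>\<phi> x = \<lfloor>x\<rfloor> + (frac x)\<^sup>2\<close>, then both \<open>\<phi> \<circ> h\<close> and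
  \<open>2 h - \<phi> \<circ> h\<close> satisfy the system and \<open>h\<close> is their midpoint, so that extreme points are
  integral.  Hence the core polytope is the solution set of this system.

  The listed inequalities imply all others, and none of them can be dropped.  For the latter,
  truncating an explicit local pattern between the least and the greatest height function yields a
  height function that violates exactly one listed inequality.  Irredundancy turns the listed
  inequalities into pairwise distinct facets and shows that there are no others.  Transposition
  reduces column inequalities to row inequalities.
\<close>

section \<open>Alternating lines and corner sums\<close>

text \<open>The corner sum \<open>h i j\<close> adds up the upper left i by j block. In row i of the
  full matrix, the middle entry is 1 minus twice the sum of the left half, which is 0 or 1; so it is
  1 or -1, and the middle column reads 1, -1, 1, ... The left half of row i then sums to 1 for even
  i and to 0 for odd i, whence \<open>h i k = i div 2\<close>.

  The dimension of the polytope is never computed. Facets are found relative to the affine space of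
  the boundary values: a point violating just one inequality and a feasible point where that
  inequality is strict tell all that is needed about the affine hull.

  Truncated patterns stay between the least and the greatest height function. This cannot violate an
  inequality in the last row or at (2, 2), where one of the two values compared is prescribed; there
  an extremal function is pushed by 1 beyond its bound at a single point. At (2, 2) and (k, k - 1)
  this also breaks a column step, but one that agrees with the row step on the affine space. For
  this reason the list is not quite symmetric under transposition.\<close>

lemma alternating_line_partial_sums:
  assumes "alternating_line n v" "p \<le> n"
  shows "((\<forall>q\<in>{1..p}. v q = 0) \<and> sum v {1..p} = 0) \<or>
    (\<exists>q\<in>{1..p}. v q \<noteq> 0 \<and> (\<forall>r\<in>{q<..p}. v r = 0) \<and> sum v {1..p} = (v q + 1) / 2)"
  using \<open>p \<le> n\<close>
proof (induction p)
  case (Suc p)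
  note alt = assms(1)[unfolded alternating_line_def]
  have pn: "p \<le> n" "Suc p \<in> {1..n}"
    using Suc.prems by auto
  have s: "sum v {1..Suc p} = sum v {1..p} + v (Suc p)"
    by simp
  from Suc.IH[OF pn(1)] show ?case
  proof
    assume h: "(\<forall>q\<in>{1..p}. v q = 0) \<and> sum v {1..p} = 0"
    show ?thesis
    proof (cases "v (Suc p) = 0")
      case True
      with h show ?thesis by (auto simp: le_Suc_eq)
    next
      case False
      moreover have "\<forall>q\<in>{1..<Suc p}. v q = 0"
        using h by auto
      ultimately have "v (Suc p) = 1"
        using alt pn(2) by blast
      with h s show ?thesis
        by (intro disjI2 bexI[of _ "Suc p"]) auto
    qed
  next
    \<comment> \<open>The last non-zero entry decides the partial sum: 1 leaves the sum 1, and -1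
      leaves 0. Both are encoded by \<open>(v q + 1) / 2\<close>.\<close>
    assume "\<exists>q\<in>{1..p}. v q \<noteq> 0 \<and> (\<forall>r\<in>{q<..p}. v r = 0) \<and> sum v {1..p} = (v q + 1) / 2"
    then obtain q where q: "q \<in> {1..p}" "v q \<noteq> 0" "\<forall>r\<in>{q<..p}. v r = 0"
      "sum v {1..p} = (v q + 1) / 2"
      by blast
    show ?thesis
    proof (cases "v (Suc p) = 0")
      case True
      with q s show ?thesis
        by (intro disjI2 bexI[of _ q]) (auto simp: le_Suc_eq)
    next
      case False
      have qn: "q \<in> {1..n}" "Suc p \<in> {q<..n}" "\<forall>r\<in>{q<..<Suc p}. v r = 0"
        using q pn by auto
      then have "sgn (v (Suc p)) = - sgn (v q)"
        using alt False q(2) by blast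
      moreover have "v q \<in> {0, 1, -1}" "v (Suc p) \<in> {0, 1, -1}"
        using alt pn(2) qn(1) by blast+
      ultimately have "v (Suc p) = - v q"
        using q(2) False by auto
      with q s False show ?thesis
        by (intro disjI2 bexI[of _ "Suc p"]) (auto simp: field_simps)
    qed
  qed
qed simp

text \<open>Alternating signs that begin and end with 1 make the partial sums toggle between 0 and 1
  and stop at 1. Conversely, a non-zero entry is a jump between these two values, so the sum before
  it determines its sign. In this form the condition becomes a linear one on corner sums.\<close>

lemma alternating_line_iff:
  "alternating_line n v \<longleftrightarrow> (\<forall>p\<le>n. sum v {1..p} \<in> {0, 1}) \<and> sum v {1..n} = 1"
proof
  assume a: "alternating_line n v"
  note alt = a[unfolded alternating_line_def]
  have "sum v {1..p} \<in> {0, 1}" if "p \<le> n" for p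
    using alternating_line_partial_sums[OF a that]
  proof
    assume "\<exists>q\<in>{1..p}. v q \<noteq> 0 \<and> (\<forall>r\<in>{q<..p}. v r = 0) \<and> sum v {1..p} = (v q + 1) / 2"
    then obtain q where q: "q \<in> {1..p}" "v q \<noteq> 0" "sum v {1..p} = (v q + 1) / 2"
      by blast
    moreover have "q \<in> {1..n}"
      using q(1) that by auto
    then have "v q \<in> {0, 1, -1}"
      using alt by blast
    ultimately show ?thesis by auto
  qed auto
  moreover have "sum v {1..n} = 1"
    using alternating_line_partial_sums[OF a order.refl]
  proof
    assume "\<exists>q\<in>{1..n}. v q \<noteq> 0 \<and> (\<forall>r\<in>{q<..n}. v r = 0) \<and> sum v {1..n} = (v q + 1) / 2"
    then obtain q where q: "q \<in> {1..n}" "v q \<noteq> 0" "\<forall>r\<in>{q<..n}. v r = 0"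
      "sum v {1..n} = (v q + 1) / 2"
      by blast
    then have "v q = 1"
      using alt by blast
    with q show ?thesis by simp
  qed (use alt in blast)
  ultimately show "(\<forall>p\<le>n. sum v {1..p} \<in> {0, 1}) \<and> sum v {1..n} = 1"
    by blast
next
  assume "(\<forall>p\<le>n. sum v {1..p} \<in> {0, 1}) \<and> sum v {1..n} = 1"
  then have s01: "\<And>p. p \<le> n \<Longrightarrow> sum v {1..p} = 0 \<or> sum v {1..p} = 1"
    and tot: "sum v {1..n} = 1"
    by auto
  have step: "sum v {1..p} = sum v {1..p - 1} + v p" if "p \<in> {1..n}" for p
    using that by (cases p) auto
  have const: "sum v {1..q} = sum v {1..p}" if "p \<le> q" "\<forall>r\<in>{p<..q}. v r = 0" for p q
  proof -
    have "sum v {1..q} = sum v {1..p} + sum v {p<..q}"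
      using that(1) by (subst sum.union_disjoint[symmetric]) (auto intro!: sum.cong)
    then show ?thesis
      using that(2) by simp
  qed
  show "alternating_line n v"
    unfolding alternating_line_def
  proof (intro conjI ballI impI)
    fix p assume p: "p \<in> {1..n}"
    then have pn: "p \<le> n" "p - 1 \<le> n" by auto
    show "v p \<in> {0, 1, -1}"
      using s01[OF pn(1)] s01[OF pn(2)] step[OF p] by auto
    show "v p = 1" if "v p \<noteq> 0 \<and> (\<forall>q\<in>{1..<p}. v q = 0)"
    proof -
      have "sum v {1..p - 1} = 0"
        using that by (intro sum.neutral) auto
      then show ?thesis
        using s01[OF pn(1)] step[OF p] that by auto
    qed
    show "v p = 1" if "v p \<noteq> 0 \<and> (\<forall>q\<in>{p<..n}. v q = 0)"
      using const[of p n] pn that tot s01[OF pn(2)] step[OF p] by auto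
    fix q assume q: "q \<in> {p<..n}"
    assume h: "v p \<noteq> 0 \<and> v q \<noteq> 0 \<and> (\<forall>r\<in>{p<..<q}. v r = 0)"
    have qn: "q \<in> {1..n}" "q \<le> n" "q - 1 \<le> n" using q p by auto
    have "sum v {1..q - 1} = sum v {1..p}"
      using q h by (intro const) auto
    then show "sgn (v q) = - sgn (v p)"
      using s01[OF pn(1)] s01[OF pn(2)] s01[OF qn(2)] step[OF p] step[OF qn(1)] h by auto
  next
    show "\<exists>p\<in>{1..n}. v p \<noteq> 0"
    proof (rule ccontr)
      assume "\<not> ?thesis"
      then have "sum v {1..n} = 0" by (intro sum.neutral) auto
      with tot show False by simp
    qed
  qed
qed

lemma sum_palindromic:
  fixes v :: "nat \<Rightarrow> 'a::comm_monoid_add"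
  assumes "\<And>j. j \<in> {1..n} \<Longrightarrow> v j = v (n + 1 - j)" "p \<le> n"
  shows "sum v {1..p} + sum v {1..n - p} = sum v {1..n}"
proof -
  have "sum v {1..n - p} = sum v {p<..n}"
  proof (rule sum.reindex_bij_witness[of _ "\<lambda>j. n + 1 - j" "\<lambda>j. n + 1 - j"])
    show "v (n + 1 - j) = v j" if "j \<in> {1..n - p}" for j
      using that by (intro assms(1)[symmetric]) auto
  qed (use assms(2) in auto)
  moreover have "sum v {1..n} = sum v {1..p} + sum v {p<..n}"
    using assms(2) by (subst sum.union_disjoint[symmetric]) (auto intro!: sum.cong)
  ultimately show ?thesis by simp
qed

lemma sum_palindromic_odd:
  fixes v :: "nat \<Rightarrow> real"
  assumes "\<And>j. j \<in> {1..2 * k + 1} \<Longrightarrow> v j = v (2 * k + 2 - j)"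
  shows "sum v {1..2 * k + 1} = 2 * sum v {1..k} + v (k + 1)"
proof -
  have "sum v {1..k} + sum v {1..2 * k + 1 - k} = sum v {1..2 * k + 1}"
    by (rule sum_palindromic) (simp_all add: assms)
  then show ?thesis by simp
qed

text \<open>Reflection pairs the partial sums of lengths p and 2k + 1 - p, which add up to the total
  1. Hence only lengths up to k and the total have to be checked.\<close>

lemma palindromic_alternating_lineI:
  fixes v :: "nat \<Rightarrow> real"
  assumes sym: "\<And>j. j \<in> {1..2 * k + 1} \<Longrightarrow> v j = v (2 * k + 2 - j)"
    and part: "\<And>p. p \<le> k \<Longrightarrow> sum v {1..p} \<in> {0, 1}"
    and mid: "2 * sum v {1..k} + v (k + 1) = 1"
  shows "alternating_line (2 * k + 1) v"
  unfolding alternating_line_iff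
proof (intro conjI allI impI)
  show tot: "sum v {1..2 * k + 1} = 1"
    using sum_palindromic_odd[of k v, OF sym] mid by simp
  fix p assume p: "p \<le> 2 * k + 1"
  show "sum v {1..p} \<in> {0, 1}"
  proof (cases "p \<le> k")
    case False
    then have "sum v {1..2 * k + 1 - p} \<in> {0, 1}"
      by (intro part) auto
    moreover have "sum v {1..p} + sum v {1..2 * k + 1 - p} = 1"
      unfolding tot[symmetric] using p by (intro sum_palindromic) (simp_all add: sym)
    ultimately show ?thesis by auto
  qed (use part in auto)
qed

section \<open>Corner sums as coordinates on the space of k by k matrices\<close>

definition corner :: "(nat \<Rightarrow> 'k::finite) \<Rightarrow> real ^ 'k ^ 'k \<Rightarrow> nat \<Rightarrow> nat \<Rightarrow> real" where
  "corner idx Y i j = (\<Sum>a=1..i. \<Sum>b=1..j. Y $ idx a $ idx b)"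

lemma corner_0 [simp]: "corner idx Y 0 j = 0" "corner idx Y i 0 = 0"
  by (simp_all add: corner_def)

lemma corner_Suc_row: "corner idx Y (Suc i) j = corner idx Y i j + row_sum idx (Suc i) j Y"
  by (simp add: corner_def row_sum_def)

lemma corner_Suc_col: "corner idx Y i (Suc j) = corner idx Y i j + col_sum idx i (Suc j) Y"
  by (simp add: corner_def col_sum_def sum.distrib)

lemma row_sum_corner: "1 \<le> i \<Longrightarrow> row_sum idx i j Y = corner idx Y i j - corner idx Y (i - 1) j"
  using corner_Suc_row[of idx Y "i - 1" j] by simp

lemma col_sum_corner: "1 \<le> j \<Longrightarrow> col_sum idx i j Y = corner idx Y i j - corner idx Y i (j - 1)"
  using corner_Suc_col[of idx Y i "j - 1"] by simp

lemma linear_corner: "linear (\<lambda>Y. corner idx Y i j)"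
  by (rule linearI) (simp_all add: corner_def sum.distrib sum_distrib_left)

lemma corner_add: "corner idx (x + y) i j = corner idx x i j + corner idx y i j"
  and corner_scaleR: "corner idx (c *\<^sub>R x) i j = c * corner idx x i j"
  using linear_add[OF linear_corner] linear_scale[OF linear_corner] by auto

text \<open>The mixed second difference, inverse to \<open>corner\<close> on functions that vanish
  on row 0 and column 0. Height functions constructed by hand enter the matrix space through
  it.\<close>

definition of_corner :: "(nat \<Rightarrow> 'k::finite) \<Rightarrow> nat \<Rightarrow> (nat \<Rightarrow> nat \<Rightarrow> real) \<Rightarrow> real ^ 'k ^ 'k" where
  "of_corner idx k h = (\<chi> a b. let i = inv_into {1..k} idx a; j = inv_into {1..k} idx b
     in h i j - h (i - 1) j - h i (j - 1) + h (i - 1) (j - 1))"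

lemma corner_of_corner:
  assumes "inj_on idx {1..k}" "\<And>i. i \<le> k \<Longrightarrow> h i 0 = 0" "\<And>j. j \<le> k \<Longrightarrow> h 0 j = 0"
    "i \<le> k" "j \<le> k"
  shows "corner idx (of_corner idx k h) i j = h i j"
proof -
  have "(\<Sum>b=1..j. of_corner idx k h $ idx a $ idx b) = h a j - h (a - 1) j"
    if a: "a \<in> {1..k}" for a
    using \<open>j \<le> k\<close>
  proof (induction j)
    case (Suc j)
    have e: "of_corner idx k h $ idx a $ idx (Suc j)
        = h a (Suc j) - h (a - 1) (Suc j) - h a j + h (a - 1) j"
      using a Suc.prems assms(1) by (simp add: of_corner_def inv_into_f_f)
    show ?case
      using Suc by (simp add: e)
  qed (use a assms(2) in auto)
  note inner = this
  have "corner idx (of_corner idx k h) i j = (\<Sum>a=1..i. h a j - h (a - 1) j)"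
    unfolding corner_def using \<open>i \<le> k\<close> by (intro sum.cong refl inner) auto
  also have "\<dots> = h i j"
    using \<open>j \<le> k\<close> assms(3) by (induction i) auto
  finally show ?thesis .
qed

lemma entry_corner:
  assumes "1 \<le> i" "1 \<le> j"
  shows "Y $ idx i $ idx j
    = corner idx Y i j - corner idx Y (i - 1) j - corner idx Y i (j - 1) + corner idx Y (i - 1) (j - 1)"
proof -
  have "row_sum idx i j Y = row_sum idx i (j - 1) Y + Y $ idx i $ idx j"
    using assms(2) by (cases j) (auto simp: row_sum_def)
  then show ?thesis
    using assms by (simp add: row_sum_corner)
qed

lemma corner_eqI:
  assumes "bij_betw idx {1..k} UNIV"
    "\<And>i j. i \<le> k \<Longrightarrow> j \<le> k \<Longrightarrow> corner idx x i j = corner idx y i j"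
  shows "x = y"
proof -
  have "x $ a $ b = y $ a $ b" for a b
  proof -
    obtain i j where ij: "i \<in> {1..k}" "j \<in> {1..k}" "a = idx i" "b = idx j"
      using assms(1) unfolding bij_betw_def by (metis UNIV_I imageE)
    then show ?thesis
      by (auto simp: entry_corner assms(2))
  qed
  then show ?thesis by (simp add: vec_eq_iff)
qed

text \<open>These equations hold on the whole polytope and cut out the affine space relative to
  which the facet inequalities are read. Row 1 and column 1 vanish because the first row and column
  of a VHSASM have their only 1 in the middle.\<close>

definition boundary :: "nat \<Rightarrow> (nat \<Rightarrow> nat \<Rightarrow> real) \<Rightarrow> bool" where
  "boundary k h \<longleftrightarrow>
     (\<forall>i\<in>{0..k}. h i 0 = 0 \<and> h i 1 = 0 \<and> h i k = real (i div 2)) \<and>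
     (\<forall>j\<in>{0..k}. h 0 j = 0 \<and> h 1 j = 0 \<and> h k j = real (j div 2))"

definition unit_step :: "real \<Rightarrow> real \<Rightarrow> bool" where
  "unit_step x y \<longleftrightarrow> x \<le> y \<and> y \<le> x + 1"

definition corner_system :: "nat \<Rightarrow> (nat \<Rightarrow> nat \<Rightarrow> real) \<Rightarrow> bool" where
  "corner_system k h \<longleftrightarrow> boundary k h \<and>
     (\<forall>i\<in>{1..k}. \<forall>j\<in>{1..k}. unit_step (h (i - 1) j) (h i j) \<and> unit_step (h i (j - 1)) (h i j))"

lemma boundary_cong:
  assumes "\<And>i j. i \<le> k \<Longrightarrow> j \<le> k \<Longrightarrow> h i j = g i j" "1 \<le> k" "boundary k h"
  shows "boundary k g"
  using assms(2,3) unfolding boundary_def by (simp add: assms(1)[symmetric])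

lemma corner_system_cong:
  assumes eq: "\<And>i j. i \<le> k \<Longrightarrow> j \<le> k \<Longrightarrow> h i j = g i j" and "1 \<le> k" "corner_system k h"
  shows "corner_system k g"
  unfolding corner_system_def
proof (intro conjI ballI)
  show "boundary k g"
    using boundary_cong[OF eq] assms(2,3) by (auto simp: corner_system_def)
  fix i j assume ij: "i \<in> {1..k}" "j \<in> {1..k}"
  then have "h i j = g i j" "h (i - 1) j = g (i - 1) j" "h i (j - 1) = g i (j - 1)"
    by (auto intro!: eq)
  then show "unit_step (g (i - 1) j) (g i j)" "unit_step (g i (j - 1)) (g i j)"
    using assms(3) ij unfolding corner_system_def by metis+
qed

lemma boundary_of_corner:
  assumes "inj_on idx {1..k}" "boundary k h" "1 \<le> k"
  shows "boundary k (corner idx (of_corner idx k h))"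
proof (rule boundary_cong[OF _ assms(3,2)])
  fix i j assume "i \<le> k" "j \<le> k"
  then show "h i j = corner idx (of_corner idx k h) i j"
    using assms(2) by (intro corner_of_corner[OF assms(1), symmetric]) (auto simp: boundary_def)
qed

lemma corner_system_of_corner:
  assumes "inj_on idx {1..k}" "corner_system k h" "1 \<le> k"
  shows "corner_system k (corner idx (of_corner idx k h))"
proof (rule corner_system_cong[OF _ assms(3,2)])
  fix i j assume "i \<le> k" "j \<le> k"
  then show "h i j = corner idx (of_corner idx k h) i j"
    using assms(2) by (intro corner_of_corner[OF assms(1), symmetric]) (auto simp: corner_system_def boundary_def)
qed

lemma boundary_transpose: "boundary k h \<Longrightarrow> boundary k (\<lambda>i j. h j i)"
  by (simp add: boundary_def)

lemma corner_system_transpose: "corner_system k h \<Longrightarrow> corner_system k (\<lambda>i j. h j i)"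
  by (simp add: corner_system_def boundary_transpose)

section \<open>Cores as integral solutions of the corner system\<close>

lemma core_nth:
  assumes "inj_on idx {1..n div 2}" "i \<in> {1..n div 2}" "j \<in> {1..n div 2}"
  shows "core idx n X $ idx i $ idx j = X i j"
  using assms by (simp add: core_def inv_into_f_f)

text \<open>By symmetry a row sum is twice its left half plus the middle entry. It equals 1 and the
  half is 0 or 1, so no middle entry is 0; a column of non-zero entries with partial sums 0 and 1
  must toggle at every step.\<close>

lemma middle_column_partial_sums:
  assumes "is_vhsasm (2 * k + 1) X" "i \<le> 2 * k + 1"
  shows "(\<Sum>a=1..i. X a (k + 1)) = of_bool (odd i)"
  using assms(2)
proof (induction i)
  case (Suc i)
  let ?n = "2 * k + 1"
  have asm: "\<And>i. i \<in> {1..?n} \<Longrightarrow> alternating_line ?n (\<lambda>j. X i j)"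
    "\<And>j. j \<in> {1..?n} \<Longrightarrow> alternating_line ?n (\<lambda>i. X i j)"
    and sym: "\<And>i j. i \<in> {1..?n} \<Longrightarrow> j \<in> {1..?n} \<Longrightarrow> X i j = X i (2 * k + 2 - j)"
    using assms(1) by (auto simp: is_vhsasm_def is_asm_def)
  have i: "Suc i \<in> {1..?n}" using Suc.prems by auto
  have "sum (X (Suc i)) {1..?n} = 2 * sum (X (Suc i)) {1..k} + X (Suc i) (k + 1)"
    by (rule sum_palindromic_odd) (rule sym[OF i])
  moreover have "sum (X (Suc i)) {1..?n} = 1" "sum (X (Suc i)) {1..k} \<in> {0, 1}"
    using asm(1)[OF i] unfolding alternating_line_iff by auto
  ultimately have "X (Suc i) (k + 1) \<in> {1, -1}" by auto
  moreover have "(\<Sum>a=1..Suc i. X a (k + 1)) \<in> {0, 1}"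
    using asm(2)[of "k + 1"] Suc.prems unfolding alternating_line_iff by auto
  moreover have "(\<Sum>a=1..i. X a (k + 1)) = of_bool (odd i)"
    using Suc by auto
  ultimately show ?case by (auto split: if_splits)
qed simp

lemma vhsasm_row_partial_sums:
  assumes "is_vhsasm (2 * k + 1) X" "i \<in> {1..k}"
  shows "p \<le> k \<Longrightarrow> sum (X i) {1..p} \<in> {0, 1}" "sum (X i) {1..k} = of_bool (even i)"
proof -
  let ?n = "2 * k + 1"
  have i: "i \<in> {1..?n}" using assms(2) by auto
  then have alt: "alternating_line ?n (X i)"
    and sym: "\<And>j. j \<in> {1..?n} \<Longrightarrow> X i j = X i (2 * k + 2 - j)"
    using assms(1) by (auto simp: is_vhsasm_def is_asm_def)
  show "p \<le> k \<Longrightarrow> sum (X i) {1..p} \<in> {0, 1}"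
    using alt unfolding alternating_line_iff by auto
  have "2 * sum (X i) {1..k} + X i (k + 1) = 1"
    using sum_palindromic_odd[of k "X i", OF sym] alt unfolding alternating_line_iff by auto
  moreover have "(\<Sum>a=1..i. X a (k + 1)) = (\<Sum>a=1..i - 1. X a (k + 1)) + X i (k + 1)"
    using assms(2) by (cases i) auto
  ultimately show "sum (X i) {1..k} = of_bool (even i)"
    using middle_column_partial_sums[OF assms(1), of i]
      middle_column_partial_sums[OF assms(1), of "i - 1"] i
    by (auto split: if_splits)
qed

lemma is_vhsasm_transpose: "is_vhsasm n X \<Longrightarrow> is_vhsasm n (\<lambda>i j. X j i)"
  unfolding is_vhsasm_def is_asm_def by blast

lemma half_increment:
  assumes "1 \<le> i"
  shows "real (i div 2) = real ((i - 1) div 2) + of_bool (even i)"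
proof -
  have "i div 2 = (i - 1) div 2 + (if even i then 1 else 0)"
    using assms by presburger
  then show ?thesis by simp
qed

text \<open>Only row 1 and column 1 call for an argument: \<open>h 1 j\<close> lies between
  \<open>h 0 j = 0\<close> and, by monotonicity in j, \<open>h 1 k = 1 div 2 = 0\<close>; likewise
  for columns.\<close>

lemma boundaryI:
  assumes "1 \<le> k" "\<And>i. i \<le> k \<Longrightarrow> h i 0 = 0" "\<And>i. i \<le> k \<Longrightarrow> h i k = real (i div 2)"
    "\<And>j. j \<le> k \<Longrightarrow> h 0 j = 0" "\<And>j. j \<le> k \<Longrightarrow> h k j = real (j div 2)"
    and steps: "\<And>i j. i \<in> {1..k} \<Longrightarrow> j \<in> {1..k} \<Longrightarrow>
      unit_step (h (i - 1) j) (h i j) \<and> unit_step (h i (j - 1)) (h i j)"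
  shows "boundary k h"
proof -
  have row: "h i j \<le> h i k" if "i \<in> {1..k}" "j \<le> k" for i j
    using that(2)
  proof (induction j rule: inc_induct)
    case (step j)
    then show ?case
      using steps[of i "Suc j"] that(1) by (auto simp: unit_step_def)
  qed simp
  have col: "h i j \<le> h k j" if "j \<in> {1..k}" "i \<le> k" for i j
    using that(2)
  proof (induction i rule: inc_induct)
    case (step i)
    then show ?case
      using steps[of "Suc i" j] that(1) by (auto simp: unit_step_def)
  qed simp
  have "h 1 j = 0" if "j \<le> k" for j
    using that assms(1) assms(2)[of 1] assms(3)[of 1] assms(4)[of j] row[of 1 j] steps[of 1 j]
    by (cases "j = 0") (auto simp: unit_step_def)
  moreover have "h i 1 = 0" if "i \<le> k" for i
    using that assms(1) assms(4)[of 1] assms(5)[of 1] assms(2)[of i] col[of 1 i] steps[of i 1]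
    by (cases "i = 0") (auto simp: unit_step_def)
  ultimately show ?thesis
    using assms(2-5) unfolding boundary_def by auto
qed

context
  fixes k :: nat and idx :: "nat \<Rightarrow> 'k::finite"
  assumes idx: "bij_betw idx {1..k} (UNIV :: 'k set)" and k: "1 \<le> k"
begin

lemma inj_idx: "inj_on idx {1..k}"
  using idx by (rule bij_betw_imp_inj_on)

lemma corner_system_core:
  assumes "is_vhsasm (2 * k + 1) X"
  shows "corner_system k (corner idx (core idx (2 * k + 1) X))"
proof -
  let ?h = "corner idx (core idx (2 * k + 1) X)"
  have nth: "core idx (2 * k + 1) X $ idx i $ idx j = X i j" if "i \<in> {1..k}" "j \<in> {1..k}" for i j
    using that inj_idx by (intro core_nth) auto
  have row: "?h i j = ?h (i - 1) j + sum (X i) {1..j}" if "i \<in> {1..k}" "j \<le> k" for i j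
    using that nth[of i] row_sum_corner[of i idx j "core idx (2 * k + 1) X"]
    by (simp add: row_sum_def)
  have col: "?h i j = ?h i (j - 1) + (\<Sum>a=1..i. X a j)" if "j \<in> {1..k}" "i \<le> k" for i j
    using that nth[of _ j] col_sum_corner[of j idx i "core idx (2 * k + 1) X"]
    by (simp add: col_sum_def)
  note rs = vhsasm_row_partial_sums[OF assms]
  note cs = vhsasm_row_partial_sums[OF is_vhsasm_transpose[OF assms]]
  have steps: "unit_step (?h (i - 1) j) (?h i j) \<and> unit_step (?h i (j - 1)) (?h i j)"
    if "i \<in> {1..k}" "j \<in> {1..k}" for i j
    using row[of i j] col[of j i] rs(1)[of i j] cs(1)[of j i] that by (auto simp: unit_step_def)
  have "?h i k = real (i div 2)" if "i \<le> k" for i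
    using that
  proof (induction i)
    case (Suc i)
    then show ?case
      using row[of "Suc i" k] rs(2)[of "Suc i"] half_increment[of "Suc i"] by auto
  qed simp
  moreover have "?h k j = real (j div 2)" if "j \<le> k" for j
    using that
  proof (induction j)
    case (Suc j)
    then show ?case
      using col[of "Suc j" k] cs(2)[of "Suc j"] half_increment[of "Suc j"] by auto
  qed simp
  ultimately have "boundary k ?h"
    using steps k by (intro boundaryI) auto
  then show ?thesis
    using steps by (simp add: corner_system_def)
qed

text \<open>The only possible extension of a core to a symmetric matrix of size 2k + 1. Indices are
  folded to \<open>{1..k + 1}\<close> by reflection, and the middle row and column carry the forced
  signs 1, -1, 1, ...; at the centre the last branch gives \<open>(- 1) ^ (k + 2)\<close>.\<close>

definition unfold_core :: "real ^ 'k ^ 'k \<Rightarrow> nat \<Rightarrow> nat \<Rightarrow> real" where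
  "unfold_core Y i j = (let a = min i (2 * k + 2 - i); b = min j (2 * k + 2 - j) in
     if a \<le> k then if b \<le> k then Y $ idx a $ idx b else (- 1) ^ (a + 1)
     else (- 1) ^ (b + 1))"

lemma sum_alternating_signs: "(\<Sum>j=1..p. (- 1 :: real) ^ (j + 1)) = of_bool (odd p)"
  by (induction p) auto

lemma unfold_core_middle: "unfold_core Y i (Suc k) = (- 1) ^ (min i (2 * k + 2 - i) + 1)"
  "unfold_core Y (Suc k) j = (- 1) ^ (min j (2 * k + 2 - j) + 1)"
proof -
  have "min (Suc k) (2 * k + 2 - Suc k) = Suc k" by simp
  moreover have "min i (2 * k + 2 - i) = Suc k" if "\<not> min i (2 * k + 2 - i) \<le> k" for i
    using that by linarith
  ultimately show "unfold_core Y i (Suc k) = (- 1) ^ (min i (2 * k + 2 - i) + 1)"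
    "unfold_core Y (Suc k) j = (- 1) ^ (min j (2 * k + 2 - j) + 1)"
    by (auto simp: unfold_core_def Let_def simp del: min_less_iff_conj)
qed

lemma corner_system_row_sums:
  assumes "corner_system k (corner idx Y)" "i \<in> {1..k}" "j \<le> k"
  shows "row_sum idx i j Y \<in> {0..1}" "row_sum idx i k Y = of_bool (even i)"
    "col_sum idx j i Y \<in> {0..1}" "col_sum idx k i Y = of_bool (even i)"
proof -
  have "corner idx Y i k = real (i div 2)" "corner idx Y k i = real (i div 2)"
    "corner idx Y (i - 1) k = real ((i - 1) div 2)" "corner idx Y k (i - 1) = real ((i - 1) div 2)"
    using assms by (auto simp: corner_system_def boundary_def)
  then show "row_sum idx i k Y = of_bool (even i)" "col_sum idx k i Y = of_bool (even i)"
    using assms(2) half_increment[of i] by (auto simp: row_sum_corner col_sum_corner)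
  show "row_sum idx i j Y \<in> {0..1}" "col_sum idx j i Y \<in> {0..1}"
  proof -
    have "row_sum idx i j Y \<in> {0..1} \<and> col_sum idx j i Y \<in> {0..1}"
    proof (cases "j = 0")
      case True
      then show ?thesis by (simp add: row_sum_def col_sum_def)
    next
      case False
      then have "j \<in> {1..k}" using assms(3) by auto
      then have "unit_step (corner idx Y (i - 1) j) (corner idx Y i j)"
        "unit_step (corner idx Y j (i - 1)) (corner idx Y j i)"
        using assms(1,2) by (auto simp: corner_system_def)
      then show ?thesis
        using assms(2) by (auto simp: row_sum_corner col_sum_corner unit_step_def)
    qed
    then show "row_sum idx i j Y \<in> {0..1}" "col_sum idx j i Y \<in> {0..1}" by auto
  qed
qed

text \<open>Partial sums of rows and columns are differences of adjacent corner sums, so integrality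
  and the unit step condition leave only 0 and 1. The prescribed values at index k make each half
  line fit its middle entry.\<close>

lemma corner_system_imp_core:
  assumes sys: "corner_system k (corner idx Y)"
    and int: "\<And>i j. i \<le> k \<Longrightarrow> j \<le> k \<Longrightarrow> corner idx Y i j \<in> \<int>"
  shows "\<exists>X. is_vhsasm (2 * k + 1) X \<and> Y = core idx (2 * k + 1) X"
proof (intro exI conjI)
  let ?n = "2 * k + 1"
  let ?X = "unfold_core Y"
  let ?f = "\<lambda>i. min i (2 * k + 2 - i)"
  have inner: "?X i j = Y $ idx i $ idx j" if "i \<le> k" "j \<le> k" for i j
  proof -
    have "?f i = i" "?f j = j" using that by auto
    then show ?thesis using that by (simp add: unfold_core_def)
  qed
  have fold: "?X i j = ?X (2 * k + 2 - i) j" "?X i j = ?X i (2 * k + 2 - j)"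
    if "i \<in> {1..?n}" "j \<in> {1..?n}" for i j
  proof -
    have "?f (2 * k + 2 - i) = ?f i" "?f (2 * k + 2 - j) = ?f j"
      using that by auto
    then show "?X i j = ?X (2 * k + 2 - i) j" "?X i j = ?X i (2 * k + 2 - j)"
      unfolding unfold_core_def by presburger+
  qed
  have int01: "x \<in> {0, 1}" if "x \<in> \<int>" "x \<in> {0..1}" for x :: real
    using that by (auto elim!: Ints_cases)
  have part: "row_sum idx i j Y \<in> {0, 1}" "col_sum idx j i Y \<in> {0, 1}"
    if "i \<in> {1..k}" "j \<le> k" for i j
  proof -
    have "row_sum idx i j Y \<in> \<int>" "col_sum idx j i Y \<in> \<int>"
      using that by (auto simp: row_sum_corner col_sum_corner intro!: Ints_diff int)
    then show "row_sum idx i j Y \<in> {0, 1}" "col_sum idx j i Y \<in> {0, 1}"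
      using int01 corner_system_row_sums[OF sys that] by simp_all
  qed
  have mid: "alternating_line ?n (\<lambda>j. ?X (k + 1) j)" "alternating_line ?n (\<lambda>j. ?X j (k + 1))"
  proof -
    have e: "sum (\<lambda>j. ?X (k + 1) j) {1..p} = of_bool (odd p)"
      "sum (\<lambda>j. ?X j (k + 1)) {1..p} = of_bool (odd p)" if "p \<le> k" for p
    proof -
      have "sum (\<lambda>j. ?X (k + 1) j) {1..p} = (\<Sum>j=1..p. (- 1) ^ (j + 1))"
        "sum (\<lambda>j. ?X j (k + 1)) {1..p} = (\<Sum>j=1..p. (- 1) ^ (j + 1))"
        using that by (auto simp: unfold_core_middle intro!: sum.cong)
      then show "sum (\<lambda>j. ?X (k + 1) j) {1..p} = of_bool (odd p)"
        "sum (\<lambda>j. ?X j (k + 1)) {1..p} = of_bool (odd p)"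
        by (simp_all only: sum_alternating_signs)
    qed
    \<comment> \<open>The centre completes the middle lines to total 1, as
      \<open>2 * of_bool (odd k) + (- 1) ^ k = 1\<close> for either parity of k.\<close>
    have m: "?X (k + 1) (k + 1) = (- 1) ^ k"
      by (simp add: unfold_core_middle)
    show "alternating_line ?n (\<lambda>j. ?X (k + 1) j)"
    proof (rule palindromic_alternating_lineI)
      show "2 * sum (\<lambda>j. ?X (k + 1) j) {1..k} + ?X (k + 1) (k + 1) = 1"
        unfolding e(1)[OF order.refl] m by simp
      show "?X (k + 1) j = ?X (k + 1) (2 * k + 2 - j)" if "j \<in> {1..?n}" for j
        using that by (intro fold) auto
    qed (use e in auto)
    show "alternating_line ?n (\<lambda>j. ?X j (k + 1))"
    proof (rule palindromic_alternating_lineI)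
      show "2 * sum (\<lambda>j. ?X j (k + 1)) {1..k} + ?X (k + 1) (k + 1) = 1"
        unfolding e(2)[OF order.refl] m by simp
      show "?X j (k + 1) = ?X (2 * k + 2 - j) (k + 1)" if "j \<in> {1..?n}" for j
        using that by (intro fold) auto
    qed (use e in auto)
  qed
  have low: "alternating_line ?n (\<lambda>j. ?X i j)" "alternating_line ?n (\<lambda>j. ?X j i)"
    if i: "i \<in> {1..k}" for i
  proof -
    have e: "sum (\<lambda>j. ?X i j) {1..p} = row_sum idx i p Y" "sum (\<lambda>j. ?X j i) {1..p} = col_sum idx p i Y"
      if "p \<le> k" for p
      using that i by (auto simp: row_sum_def col_sum_def inner intro!: sum.cong)
    have m: "?X i (k + 1) = (- 1) ^ (i + 1)" "?X (k + 1) i = (- 1) ^ (i + 1)"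
      using i by (auto simp: unfold_core_middle min_def)
    note rs = corner_system_row_sums[OF sys i order.refl]
    show "alternating_line ?n (\<lambda>j. ?X i j)"
    proof (rule palindromic_alternating_lineI)
      show "2 * sum (\<lambda>j. ?X i j) {1..k} + ?X i (k + 1) = 1"
        unfolding e(1)[OF order.refl] m rs by simp
      show "sum (\<lambda>j. ?X i j) {1..p} \<in> {0, 1}" if "p \<le> k" for p
        unfolding e(1)[OF that] by (rule part(1)[OF i that])
      show "?X i j = ?X i (2 * k + 2 - j)" if "j \<in> {1..?n}" for j
        using i that by (intro fold) auto
    qed
    show "alternating_line ?n (\<lambda>j. ?X j i)"
    proof (rule palindromic_alternating_lineI)
      show "2 * sum (\<lambda>j. ?X j i) {1..k} + ?X (k + 1) i = 1"
        unfolding e(2)[OF order.refl] m rs by simp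
      show "sum (\<lambda>j. ?X j i) {1..p} \<in> {0, 1}" if "p \<le> k" for p
        unfolding e(2)[OF that] by (rule part(2)[OF i that])
      show "?X j i = ?X (2 * k + 2 - j) i" if "j \<in> {1..?n}" for j
        using i that by (intro fold) auto
    qed
  qed
  have all: "alternating_line ?n (\<lambda>j. ?X i j)" "alternating_line ?n (\<lambda>j. ?X j i)"
    if i: "i \<in> {1..?n}" for i
  proof -
    define a where "a = ?f i"
    have a: "a = min a (2 * k + 2 - a)" "a \<in> {1..k} \<or> a = k + 1"
      using i by (auto simp: a_def)
    then have eq: "?X i j = ?X a j" "?X j i = ?X j a" for j
      unfolding unfold_core_def a_def[symmetric] by simp_all
    from a(2) have "alternating_line ?n (\<lambda>j. ?X a j)" "alternating_line ?n (\<lambda>j. ?X j a)"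
      using low[of a] mid by auto
    then show "alternating_line ?n (\<lambda>j. ?X i j)" "alternating_line ?n (\<lambda>j. ?X j i)"
      unfolding eq by simp_all
  qed
  show "is_vhsasm ?n ?X"
    unfolding is_vhsasm_def is_asm_def using all fold by simp
  show "Y = core idx ?n ?X"
  proof -
    have "Y $ a $ b = core idx ?n ?X $ a $ b" for a b
    proof -
      obtain i j where ij: "i \<in> {1..k}" "j \<in> {1..k}" "a = idx i" "b = idx j"
        using idx unfolding bij_betw_def by (metis UNIV_I imageE)
      then show ?thesis
        using core_nth[of idx ?n i j ?X] inj_idx inner[of i j] by auto
    qed
    then show ?thesis by (simp add: vec_eq_iff)
  qed
qed

end

section \<open>Facets of an irredundantly described polyhedron\<close>

lemma linear_functional_inner:
  fixes f :: "'a::euclidean_space \<Rightarrow> real"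
  assumes "linear f"
  shows "f x = (\<Sum>b\<in>Basis. f b *\<^sub>R b) \<bullet> x"
proof -
  have "f x = f (\<Sum>b\<in>Basis. (x \<bullet> b) *\<^sub>R b)"
    by (simp add: euclidean_representation)
  also have "\<dots> = (\<Sum>b\<in>Basis. (x \<bullet> b) * f b)"
    using assms by (simp add: linear_sum linear_scale)
  also have "\<dots> = (\<Sum>b\<in>Basis. f b *\<^sub>R b) \<bullet> x"
    unfolding inner_sum_left by (intro sum.cong) (simp_all add: inner_commute)
  finally show ?thesis .
qed

text \<open>A point violating one inequality alone shows that this inequality cannot be dropped, and
  the facets of an irredundantly described polyhedron are its tight sets. The affine space
  \<open>A\<close> is not assumed to be the affine hull of \<open>S\<close>: the strict points make
  the violating points lie in that hull.\<close>

lemma bij_betw_facets: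
  fixes f :: "'e \<Rightarrow> 'a::euclidean_space \<Rightarrow> real"
  assumes fin: "finite E" and aff: "affine A" and lin: "\<And>e. e \<in> E \<Longrightarrow> linear (f e)"
    and S: "S = {x\<in>A. \<forall>e\<in>E. f e x \<le> c e}"
    and strict: "\<And>e. e \<in> E \<Longrightarrow> \<exists>s\<in>S. f e s < c e"
    and violating: "\<And>e. e \<in> E \<Longrightarrow> \<exists>w\<in>A. f e w > c e \<and> (\<forall>e'\<in>E - {e}. f e' w \<le> c e')"
    and ne: "E \<noteq> {}"
  shows "bij_betw (\<lambda>e. {x\<in>S. f e x = c e}) E {F. F facet_of S}"
proof -
  define v where "v e = (\<Sum>b\<in>Basis. f e b *\<^sub>R b)" for e
  have fv: "f e x = v e \<bullet> x" if "e \<in> E" for e x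
    unfolding v_def by (rule linear_functional_inner[OF lin[OF that]])
  have SA: "S \<subseteq> A" and Sle: "\<And>e x. e \<in> E \<Longrightarrow> x \<in> S \<Longrightarrow> f e x \<le> c e"
    using S by auto
  have hull_A: "affine hull S \<subseteq> A"
    using SA aff by (simp add: hull_minimal)
  define H where "H e = {x. v e \<bullet> x \<le> c e}" for e
  \<comment> \<open>On the segment from the strict point \<open>s\<close> to \<open>w\<close>, the
    inequality \<open>e\<close> becomes tight at \<open>?p\<close>, where all others still hold. So
    \<open>s\<close> and \<open>?p\<close> are distinct points of \<open>S\<close>, and
    \<open>w\<close> is on the line through them.\<close>
  have w: "\<exists>w. w \<in> affine hull S \<and> f e w > c e \<and> (\<forall>e'\<in>E - {e}. f e' w \<le> c e')" if e: "e \<in> E" for e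
  proof -
    obtain w where w: "w \<in> A" "f e w > c e" "\<And>e'. e' \<in> E - {e} \<Longrightarrow> f e' w \<le> c e'"
      using violating[OF e] by blast
    obtain s where s: "s \<in> S" "f e s < c e"
      using strict[OF e] by blast
    define t where "t = (c e - f e s) / (f e w - f e s)"
    have t: "0 < t" "t < 1" "t * (f e w - f e s) = c e - f e s"
      using w(2) s(2) by (auto simp: t_def field_simps)
    let ?p = "(1 - t) *\<^sub>R s + t *\<^sub>R w"
    have f: "f e' ?p = (1 - t) * f e' s + t * f e' w" if "e' \<in> E" for e'
      using lin[OF that] by (simp add: linear_add linear_scale)
    have "?p \<in> A"
      using mem_affine[OF aff, of s w "1 - t" t] s(1) w(1) SA by auto
    moreover have "f e' ?p \<le> c e'" if e': "e' \<in> E" for e'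
    proof (cases "e' = e")
      case True
      then show ?thesis using f[OF e] t(3) by (simp add: algebra_simps)
    next
      case False
      then show ?thesis
        unfolding f[OF e'] using w(3)[of e'] Sle[OF e' s(1)] e' t
        by (intro convex_bound_le) auto
    qed
    ultimately have "?p \<in> S" unfolding S by blast
    have "(1 / t) *\<^sub>R ?p = (1 / t - 1) *\<^sub>R s + w"
      using \<open>0 < t\<close> by (simp add: scaleR_right_distrib diff_divide_distrib)
    then have "w = (1 - 1 / t) *\<^sub>R s + (1 / t) *\<^sub>R ?p"
      by (simp add: scaleR_left_diff_distrib)
    moreover have "\<dots> \<in> affine hull S"
      using hull_inc[OF s(1), of affine] hull_inc[OF \<open>?p \<in> S\<close>, of affine]
      by (rule mem_affine[OF affine_affine_hull]) simp_all
    ultimately have "w \<in> affine hull S" by (simp only:)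
    then show ?thesis using w(2,3) by blast
  qed
  \<comment> \<open>\<open>facet_of_polyhedron_explicit\<close> is about a set of half-spaces. A
    point violating \<open>e\<close> alone separates \<open>H e\<close> from every other
    \<open>H e'\<close>, so half-spaces can stand for equations.\<close>
  have inj: "inj_on H E"
  proof (rule inj_onI, rule ccontr)
    fix e e' assume e: "e \<in> E" "e' \<in> E" "H e = H e'" "e \<noteq> e'"
    then obtain w where "f e w > c e" "f e' w \<le> c e'"
      using w[of e] by auto
    then have "w \<in> H e'" "w \<notin> H e"
      using e(1,2) by (auto simp: H_def fv)
    with e(3) show False by simp
  qed
  define g where "g = inv_into E H"
  have g: "g (H e) = e" if "e \<in> E" for e
    using that inj by (simp add: g_def)
  let ?F = "H ` E"
  have finF: "finite ?F" using fin by simp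
  have eqS: "S = affine hull S \<inter> \<Inter>?F"
  proof
    show "S \<subseteq> affine hull S \<inter> \<Inter>?F"
      using Sle by (auto simp: H_def fv intro: hull_inc)
    show "affine hull S \<inter> \<Inter>?F \<subseteq> S"
      using hull_A unfolding S by (auto simp: H_def fv)
  qed
  have half: "v (g h) \<noteq> 0 \<and> h = {x. v (g h) \<bullet> x \<le> c (g h)}" if "h \<in> ?F" for h
  proof -
    obtain e where e: "e \<in> E" "h = H e" using \<open>h \<in> ?F\<close> by blast
    have "v e \<noteq> 0"
    proof
      assume "v e = 0"
      then have "f e x = 0" for x using fv[OF e(1)] by simp
      then show False using w[OF e(1)] strict[OF e(1)] by force
    qed
    then show ?thesis using e g by (simp add: H_def)
  qed
  have minimal: "S \<subset> affine hull S \<inter> \<Inter>F'" if F': "F' \<subset> ?F" for F'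
  proof -
    obtain e where e: "e \<in> E" "H e \<notin> F'" using F' by blast
    obtain w where w: "w \<in> affine hull S" "f e w > c e" "\<forall>e'\<in>E - {e}. f e' w \<le> c e'"
      using w[OF e(1)] by blast
    have "w \<in> \<Inter>F'"
    proof
      fix h assume h: "h \<in> F'"
      then obtain e' where e': "e' \<in> E" "h = H e'" using F' by blast
      then have "e' \<noteq> e" using h e(2) by blast
      then show "w \<in> h" using w(3) e' by (auto simp: H_def fv)
    qed
    moreover have "w \<notin> S" using Sle[OF e(1)] w(2) by force
    moreover have "S \<subseteq> \<Inter>F'" using eqS F' by blast
    ultimately show ?thesis using w(1) hull_subset[of S affine] by blast
  qed
  have tight: "S \<inter> {x. v (g h) \<bullet> x = c (g h)} = {x\<in>S. f e x = c e}" if "e \<in> E" "h = H e" for e h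
    using fv[OF that(1)] g[OF that(1)] that(2) by auto
  have "F facet_of S \<longleftrightarrow> (\<exists>e\<in>E. F = {x\<in>S. f e x = c e})" for F
  proof -
    have "F facet_of S \<longleftrightarrow> (\<exists>h. h \<in> ?F \<and> F = S \<inter> {x. v (g h) \<bullet> x = c (g h)})"
      by (rule facet_of_polyhedron_explicit[OF finF eqS half minimal])
    also have "\<dots> \<longleftrightarrow> (\<exists>e\<in>E. F = S \<inter> {x. v (g (H e)) \<bullet> x = c (g (H e))})"
      by blast
    also have "\<dots> \<longleftrightarrow> (\<exists>e\<in>E. F = {x\<in>S. f e x = c e})"
      by (intro bex_cong refl) (simp only: tight[OF _ refl])
    finally show ?thesis .
  qed
  then have facets: "{F. F facet_of S} = (\<lambda>e. {x\<in>S. f e x = c e}) ` E"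
    by blast
  have "polyhedron S"
    unfolding polyhedron_Int_affine
  proof (intro exI[of _ ?F] conjI ballI)
    fix h assume "h \<in> ?F"
    from half[OF this] show "\<exists>a b. a \<noteq> 0 \<and> h = {x. a \<bullet> x \<le> b}" by blast
  qed (rule finF eqS)+
  then have "convex S" by (rule polyhedron_imp_convex)
  moreover have "S \<noteq> {}" using strict ne by blast
  ultimately have "rel_interior S \<noteq> {}"
    using rel_interior_eq_empty by blast
  then obtain z where "z \<in> rel_interior S" by blast
  then have "z \<in> S" "\<forall>h\<in>?F. v (g h) \<bullet> z < c (g h)"
    using rel_interior_polyhedron_explicit[OF finF eqS half minimal] by blast+
  then have z: "z \<in> S" "\<And>e. e \<in> E \<Longrightarrow> f e z < c e"
    using g fv by simp_all
  \<comment> \<open>Starting from \<open>z\<close>, where every inequality is strict, the segment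
    towards the point violating \<open>e\<close> reaches a point \<open>?p\<close> of
    \<open>S\<close> at which \<open>e\<close> is the only tight inequality. It lies on the face of
    \<open>e\<close> and on no other.\<close>
  have "inj_on (\<lambda>e. {x\<in>S. f e x = c e}) E"
  proof (rule inj_onI, rule ccontr)
    fix e d assume e: "e \<in> E" and d: "d \<in> E" and ed: "e \<noteq> d"
      and same: "{x\<in>S. f e x = c e} = {x\<in>S. f d x = c d}"
    obtain w where w: "w \<in> A" "f e w > c e" "\<And>e'. e' \<in> E - {e} \<Longrightarrow> f e' w \<le> c e'"
      using violating[OF e] by blast
    define t where "t = (c e - f e z) / (f e w - f e z)"
    have t: "0 < t" "t < 1" "t * (f e w - f e z) = c e - f e z"
      using w(2) z(2)[OF e] by (auto simp: t_def field_simps)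
    let ?p = "(1 - t) *\<^sub>R z + t *\<^sub>R w"
    have f: "f e' ?p = (1 - t) * f e' z + t * f e' w" if "e' \<in> E" for e'
      using lin[OF that] by (simp add: linear_add linear_scale)
    have "?p \<in> A"
      using mem_affine[OF aff, of z w "1 - t" t] z(1) w(1) SA by auto
    moreover have tight: "f e ?p = c e"
      using f[OF e] t(3) by (simp add: algebra_simps)
    moreover have less: "f e' ?p < c e'" if e': "e' \<in> E" "e' \<noteq> e" for e'
    proof -
      have "(1 - t) * f e' z < (1 - t) * c e'" "t * f e' w \<le> t * c e'"
        using w(3)[of e'] z(2)[of e'] e' t by auto
      then show ?thesis unfolding f[OF e'(1)] by (simp add: algebra_simps)
    qed
    moreover have "f e' ?p \<le> c e'" if "e' \<in> E" for e'
      using less[OF that] tight by (cases "e' = e") simp_all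
    ultimately have "?p \<in> S"
      unfolding S by blast
    then have "?p \<in> {x\<in>S. f d x = c d}"
      using tight unfolding same[symmetric] by blast
    then show False using less[OF d] ed by simp
  qed
  then show ?thesis
    unfolding facets by (rule inj_on_imp_bij_betw)
qed

section \<open>Integrality\<close>

text \<open>Any nondecreasing map that commutes with adding 1 preserves unit steps; this one and its
  reflection \<open>2 x - frac_square x\<close> do, and both fix only the integers.\<close>

definition frac_square :: "real \<Rightarrow> real" where
  "frac_square x = of_int \<lfloor>x\<rfloor> + (frac x)\<^sup>2"

lemma frac_square_of_int [simp]: "frac_square (of_int n) = of_int n"
  by (simp add: frac_square_def)

lemma frac_square_of_nat [simp]: "frac_square (of_nat n) = of_nat n" "frac_square 0 = 0"
  using frac_square_of_int[of "int n"] frac_square_of_int[of 0] by simp_all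

lemma frac_square_fixed: "frac_square x = x \<Longrightarrow> x \<in> \<int>"
proof -
  assume "frac_square x = x"
  then have "(frac x)\<^sup>2 = frac x"
    unfolding frac_square_def by (simp add: frac_def)
  then have "frac x = 0 \<or> frac x = 1"
    by (simp add: power2_eq_square)
  then show "x \<in> \<int>"
    using frac_lt_1[of x] by (auto simp: frac_eq_0_iff)
qed

text \<open>Over a unit step the floor stays, and then p \<le> q, or grows by 1, and then q \<le> p.
  All claims reduce to comparing squares of p and q, or of 1 - p and 1 - q, because 2p - p*p = 1 -
  (1 - p)*(1 - p). The square serves since on [0,1] it fixes the end points and has slope between 0
  and 2, so that it and its reflection both increase.\<close>

lemma unit_step_frac_square:
  assumes "unit_step x y"
  shows "unit_step (frac_square x) (frac_square y)"
    and "unit_step (2 * x - frac_square x) (2 * y - frac_square y)"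
proof -
  define p q where "p = frac x" and "q = frac y"
  have pq: "0 \<le> p" "p < 1" "0 \<le> q" "q < 1"
    by (auto simp: p_def q_def frac_lt_1)
  have x: "x = of_int \<lfloor>x\<rfloor> + p" "frac_square x = of_int \<lfloor>x\<rfloor> + p\<^sup>2"
    and y: "y = of_int \<lfloor>y\<rfloor> + q" "frac_square y = of_int \<lfloor>y\<rfloor> + q\<^sup>2"
    by (auto simp: p_def q_def frac_def frac_square_def)
  have sq: "0 \<le> p\<^sup>2" "p\<^sup>2 \<le> p" "0 \<le> q\<^sup>2" "q\<^sup>2 \<le> q" "0 \<le> (1 - p)\<^sup>2" "0 \<le> (1 - q)\<^sup>2"
    using pq by (auto simp: power2_eq_square mult_left_le)
  have sq': "(1 - p)\<^sup>2 = 1 - 2 * p + p\<^sup>2" "(1 - q)\<^sup>2 = 1 - 2 * q + q\<^sup>2"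
    by (auto simp: power2_eq_square algebra_simps)
  have "\<lfloor>y\<rfloor> = \<lfloor>x\<rfloor> \<or> \<lfloor>y\<rfloor> = \<lfloor>x\<rfloor> + 1"
    using assms unfolding unit_step_def by linarith
  then show "unit_step (frac_square x) (frac_square y)"
    "unit_step (2 * x - frac_square x) (2 * y - frac_square y)"
  proof (atomize (full), elim disjE)
    assume e: "\<lfloor>y\<rfloor> = \<lfloor>x\<rfloor>"
    then have "p \<le> q" using assms x(1) y(1) by (auto simp: unit_step_def)
    then have "p\<^sup>2 \<le> q\<^sup>2" "(1 - q)\<^sup>2 \<le> (1 - p)\<^sup>2"
      using pq by (auto intro!: power_mono)
    moreover have "real_of_int \<lfloor>y\<rfloor> = of_int \<lfloor>x\<rfloor>"
      using e by simp
    ultimately show "unit_step (frac_square x) (frac_square y) \<and>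
      unit_step (2 * x - frac_square x) (2 * y - frac_square y)"
      unfolding unit_step_def x(2) y(2) using x(1) y(1) pq sq sq' by (intro conjI) linarith+
  next
    assume e: "\<lfloor>y\<rfloor> = \<lfloor>x\<rfloor> + 1"
    then have "q \<le> p" using assms x(1) y(1) by (auto simp: unit_step_def)
    then have "q\<^sup>2 \<le> p\<^sup>2" "(1 - p)\<^sup>2 \<le> (1 - q)\<^sup>2"
      using pq by (auto intro!: power_mono)
    moreover have "real_of_int \<lfloor>y\<rfloor> = of_int \<lfloor>x\<rfloor> + 1"
      using e by simp
    ultimately show "unit_step (frac_square x) (frac_square y) \<and>
      unit_step (2 * x - frac_square x) (2 * y - frac_square y)"
      unfolding unit_step_def x(2) y(2) using x(1) y(1) pq sq sq' by (intro conjI) linarith+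
  qed
qed

text \<open>The boundary values are natural numbers, so both maps leave them unchanged.\<close>

lemma corner_system_frac_square:
  assumes "corner_system k h"
  shows "corner_system k (\<lambda>i j. frac_square (h i j))"
    and "corner_system k (\<lambda>i j. 2 * h i j - frac_square (h i j))"
  using assms unfolding corner_system_def boundary_def
  by (simp_all add: unit_step_frac_square)

lemma unit_step_convex:
  assumes "unit_step x y" "unit_step x' y'" "0 \<le> u" "0 \<le> v" "u + v = 1"
  shows "unit_step (u * x + v * x') (u * y + v * y')"
proof -
  have "u * x \<le> u * y" "v * x' \<le> v * y'" "u * y \<le> u * (x + 1)" "v * y' \<le> v * (x' + 1)"
    using assms by (auto simp: unit_step_def intro!: mult_left_mono)
  then show ?thesis using assms(5) by (auto simp: unit_step_def algebra_simps)
qed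

lemma boundary_affine:
  assumes "boundary k g" "boundary k h" "u + v = 1"
  shows "boundary k (\<lambda>i j. u * g i j + v * h i j)"
proof -
  have "u * x + v * x = x" for x
    using assms(3) by (metis distrib_right mult_1)
  then show ?thesis using assms(1,2) by (simp add: boundary_def)
qed

lemma corner_system_convex:
  assumes "corner_system k g" "corner_system k h" "0 \<le> u" "0 \<le> v" "u + v = 1"
  shows "corner_system k (\<lambda>i j. u * g i j + v * h i j)"
  using assms unfolding corner_system_def by (simp add: boundary_affine unit_step_convex)

lemma extreme_point_midpoint:
  "x extreme_point_of S \<Longrightarrow> a \<in> S \<Longrightarrow> b \<in> S \<Longrightarrow> x = midpoint a b \<Longrightarrow> a = b"
  unfolding extreme_point_of_def by (metis midpoint_in_open_segment)

lemma closed_corner_system: "closed {Y. corner_system k (corner idx Y)}"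
proof -
  have cont: "continuous_on UNIV (\<lambda>Y. corner idx Y i j)" for i j
    by (intro linear_continuous_on linear_conv_bounded_linear[THEN iffD1] linear_corner)
  show ?thesis
    unfolding corner_system_def boundary_def unit_step_def Ball_def
    by (intro closed_Collect_conj closed_Collect_all closed_Collect_imp open_Collect_const
        closed_Collect_eq closed_Collect_le cont continuous_intros)
qed

context
  fixes k :: nat and idx :: "nat \<Rightarrow> 'k::finite"
  assumes idx: "bij_betw idx {1..k} (UNIV :: 'k set)" and k: "1 \<le> k"
begin

lemma compact_corner_system: "compact {Y. corner_system k (corner idx Y)}"
proof -
  have "norm Y \<le> real (CARD('k) * CARD('k))" if sys: "corner_system k (corner idx Y)" for Y
  proof -
    \<comment> \<open>An entry is the difference of two consecutive partial row sums, and these lie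
      in [0,1].\<close>
    have entry: "\<bar>Y $ a $ b\<bar> \<le> 1" for a b
    proof -
      obtain i j where ij: "i \<in> {1..k}" "j \<in> {1..k}" "a = idx i" "b = idx j"
        using idx unfolding bij_betw_def by (metis UNIV_I imageE)
      have "row_sum idx i j Y = row_sum idx i (j - 1) Y + Y $ a $ b"
        using ij by (cases j) (auto simp: row_sum_def)
      moreover have "row_sum idx i j Y \<in> {0..1}" "row_sum idx i (j - 1) Y \<in> {0..1}"
        using ij corner_system_row_sums(1)[OF idx k sys, of i] by auto
      ultimately show ?thesis by auto
    qed
    have "norm (Y $ a) \<le> real CARD('k)" for a
    proof -
      have "norm (Y $ a) \<le> (\<Sum>b\<in>UNIV. \<bar>Y $ a $ b\<bar>)"
        by (rule norm_le_l1_cart)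
      also have "\<dots> \<le> (\<Sum>b\<in>(UNIV :: 'k set). 1)"
        by (intro sum_mono entry)
      finally show ?thesis by simp
    qed
    then have "(\<Sum>a\<in>UNIV. norm (Y $ a)) \<le> (\<Sum>a\<in>(UNIV :: 'k set). real CARD('k))"
      by (intro sum_mono)
    moreover have "norm Y \<le> (\<Sum>a\<in>UNIV. norm (Y $ a))"
      unfolding norm_vec_def by (intro L2_set_le_sum) auto
    ultimately show ?thesis by simp
  qed
  then show ?thesis
    using closed_corner_system by (auto simp: compact_eq_bounded_closed bounded_iff)
qed

lemma convex_corner_system: "convex {Y. corner_system k (corner idx Y)}"
proof -
  have "corner idx (u *\<^sub>R x + v *\<^sub>R y) = (\<lambda>i j. u * corner idx x i j + v * corner idx y i j)"
    for x y :: "real ^ 'k ^ 'k" and u v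
    by (intro ext) (simp add: corner_add corner_scaleR)
  then show ?thesis
    unfolding convex_def by (simp add: corner_system_convex)
qed

lemma extreme_point_integral:
  assumes "Y extreme_point_of {Y. corner_system k (corner idx Y)}" "i \<le> k" "j \<le> k"
  shows "corner idx Y i j \<in> \<int>"
proof -
  have inj: "inj_on idx {1..k}" using idx by (rule bij_betw_imp_inj_on)
  let ?h = "corner idx Y"
  let ?g = "\<lambda>i j. frac_square (?h i j)" and ?g' = "\<lambda>i j. 2 * ?h i j - frac_square (?h i j)"
  let ?Y = "of_corner idx k ?g" and ?Y' = "of_corner idx k ?g'"
  have sys: "corner_system k ?h"
    using assms(1) by (auto simp: extreme_point_of_def)
  note sys' = corner_system_frac_square[OF sys]
  have c: "corner idx ?Y i j = ?g i j" "corner idx ?Y' i j = ?g' i j" if "i \<le> k" "j \<le> k" for i j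
    using that by (intro corner_of_corner[OF inj]; simp)+
  have "?Y \<in> {Y. corner_system k (corner idx Y)}" "?Y' \<in> {Y. corner_system k (corner idx Y)}"
    unfolding mem_Collect_eq by (intro corner_system_of_corner[OF inj _ k] sys')+
  moreover have "Y = midpoint ?Y ?Y'"
    by (rule corner_eqI[OF idx]) (simp add: midpoint_def corner_scaleR corner_add c)
  ultimately have "?Y = ?Y'"
    by (rule extreme_point_midpoint[OF assms(1)])
  then have "corner idx ?Y i j = corner idx ?Y' i j"
    by (rule arg_cong[where f = "\<lambda>Y. corner idx Y i j"])
  then have "?g i j = ?g' i j"
    unfolding c[OF assms(2,3)] .
  then show ?thesis
    by (intro frac_square_fixed) linarith
qed

lemma core_polytope_eq: "core_polytope idx (2 * k + 1) = {Y. corner_system k (corner idx Y)}"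
proof
  show "core_polytope idx (2 * k + 1) \<subseteq> {Y. corner_system k (corner idx Y)}"
    unfolding core_polytope_def
  proof (intro hull_minimal convex_corner_system subsetI, elim CollectE exE conjE)
    fix x X assume "x = core idx (2 * k + 1) X" "is_vhsasm (2 * k + 1) X"
    then show "x \<in> {Y. corner_system k (corner idx Y)}"
      using corner_system_core[OF idx k] by blast
  qed
  \<comment> \<open>Extreme points are integral, hence cores; the Krein-Milman theorem for compact
    convex sets then gives the remaining inclusion.\<close>
  have "{Y. Y extreme_point_of {Y. corner_system k (corner idx Y)}}
      \<subseteq> {core idx (2 * k + 1) X | X. is_vhsasm (2 * k + 1) X}"
  proof safe
    fix Y assume "Y extreme_point_of {Y. corner_system k (corner idx Y)}"
    moreover from this have "corner_system k (corner idx Y)"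
      by (auto simp: extreme_point_of_def)
    ultimately show "\<exists>X. Y = core idx (2 * k + 1) X \<and> is_vhsasm (2 * k + 1) X"
      using corner_system_imp_core[OF idx k, of Y] extreme_point_integral[of Y] by metis
  qed
  then have "convex hull {Y. Y extreme_point_of {Y. corner_system k (corner idx Y)}}
      \<subseteq> core_polytope idx (2 * k + 1)"
    unfolding core_polytope_def by (rule hull_mono)
  then show "{Y. corner_system k (corner idx Y)} \<subseteq> core_polytope idx (2 * k + 1)"
    by (subst Krein_Milman_Minkowski[OF compact_corner_system convex_corner_system])
qed

end

section \<open>Redundant inequalities\<close>

text \<open>The facet given by an equation \<open>e\<close> is cut out by the inequality \<open>lhs e h \<le> rhs e\<close>: a sum
  that equals 0 on the facet is nonnegative, one that equals 1 is at most 1.\<close>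

fun lhs :: "equation \<Rightarrow> (nat \<Rightarrow> nat \<Rightarrow> real) \<Rightarrow> real" where
  "lhs (Row_Eq i j c) h = (if c = 0 then - 1 else 1) * (h i j - h (i - 1) j)"
| "lhs (Col_Eq i j c) h = (if c = 0 then - 1 else 1) * (h i j - h i (j - 1))"

fun rhs :: "equation \<Rightarrow> real" where
  "rhs (Row_Eq i j c) = c"
| "rhs (Col_Eq i j c) = c"

fun flip :: "equation \<Rightarrow> equation" where
  "flip (Row_Eq i j c) = Col_Eq j i c"
| "flip (Col_Eq i j c) = Row_Eq j i c"

lemma flip_flip [simp]: "flip (flip e) = e"
  by (cases e) auto

lemma lhs_flip: "lhs e (\<lambda>i j. h j i) = lhs (flip e) h"
  by (cases e) auto

lemma rhs_flip [simp]: "rhs (flip e) = rhs e"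
  by (cases e) auto

lemma Row_Eq_facet_equations:
  "Row_Eq i j c \<in> facet_equations k \<longleftrightarrow>
    c = 0 \<and> (i, j) \<in> row_zero_indices k \<or> c = 1 \<and> (i, j) \<in> row_one_indices k"
  by (auto simp: facet_equations_def)

text \<open>Measures how far the list is from being closed under transposition. Only two positions
  fail, so most statements about columns follow from those about rows.\<close>

lemma Col_Eq_facet_equations:
  assumes "4 \<le> k"
  shows "Col_Eq i j c \<in> facet_equations k \<longleftrightarrow>
    Row_Eq j i c \<in> facet_equations k \<and> (i, j) \<noteq> (2, 2) \<and> (i, j) \<noteq> (k - 1, k)"
proof -
  have "(i, j) \<in> col_zero_indices k \<longleftrightarrow>
      (j, i) \<in> row_zero_indices k \<and> (i, j) \<noteq> (2, 2) \<and> (i, j) \<noteq> (k - 1, k)"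
    using assms by (auto simp: col_zero_indices_def row_zero_indices_def)
  moreover have "(i, j) \<in> col_one_indices k \<longleftrightarrow>
      (j, i) \<in> row_one_indices k \<and> (i, j) \<noteq> (2, 2) \<and> (i, j) \<noteq> (k - 1, k)"
    using assms by (auto simp: col_one_indices_def row_one_indices_def)
  ultimately show ?thesis
    by (auto simp: facet_equations_def)
qed

text \<open>At (2, 2) the steps start from \<open>h 1 2 = 0\<close> and \<open>h 2 1 = 0\<close>; at
  the other position they start from \<open>h (k - 1) (k - 1)\<close> and end in
  \<open>h k (k - 1) = h (k - 1) k\<close>. Row and column version are therefore the same
  inequality.\<close>

lemma flip_not_facet_equation:
  assumes "4 \<le> k" "e \<in> facet_equations k" "flip e \<notin> facet_equations k" "boundary k h"
  shows "lhs (flip e) h = lhs e h"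
proof (cases e)
  case (Row_Eq i j c)
  then have "(i, j) = (2, 2) \<or> (i, j) = (k, k - 1)"
    using assms(1-3) Col_Eq_facet_equations[of k j i c] by auto
  moreover have "h 1 2 = 0" "h 2 1 = 0" "h k (k - 1) = h (k - 1) k"
    using assms(1,4) by (auto simp: boundary_def)
  ultimately show ?thesis
    using Row_Eq by auto
next
  case (Col_Eq i j c)
  then show ?thesis
    using assms(1-3) Col_Eq_facet_equations[of k i j c] by auto
qed

definition facet_inequalities :: "nat \<Rightarrow> (nat \<Rightarrow> nat \<Rightarrow> real) \<Rightarrow> bool" where
  "facet_inequalities k h \<longleftrightarrow> (\<forall>e\<in>facet_equations k. lhs e h \<le> rhs e)"

lemma facet_inequalities_transpose:
  assumes "4 \<le> k" "boundary k h" "facet_inequalities k h"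
  shows "facet_inequalities k (\<lambda>i j. h j i)"
  unfolding facet_inequalities_def
proof
  fix e assume e: "e \<in> facet_equations k"
  have "lhs (flip e) h \<le> rhs e"
  proof (cases "flip e \<in> facet_equations k")
    case True
    then have "lhs (flip e) h \<le> rhs (flip e)"
      using assms(3) unfolding facet_inequalities_def by blast
    then show ?thesis by simp
  next
    case False
    then show ?thesis
      using flip_not_facet_equation[OF assms(1) e _ assms(2)] assms(3) e
      by (simp add: facet_inequalities_def)
  qed
  then show "lhs e (\<lambda>i j. h j i) \<le> rhs e"
    by (subst lhs_flip)
qed

lemma facet_inequalities_rows:
  assumes "facet_inequalities k h"
  shows "(i, j) \<in> row_zero_indices k \<Longrightarrow> h (i - 1) j \<le> h i j"
    and "(i, j) \<in> row_one_indices k \<Longrightarrow> h i j \<le> h (i - 1) j + 1"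
  using assms Row_Eq_facet_equations[of i j 0 k] Row_Eq_facet_equations[of i j 1 k]
  by (force simp: facet_inequalities_def)+

lemma facet_inequalities_cols:
  assumes "4 \<le> k" "boundary k h" "facet_inequalities k h"
  shows "(j, i) \<in> row_zero_indices k \<Longrightarrow> h i (j - 1) \<le> h i j"
    and "(j, i) \<in> row_one_indices k \<Longrightarrow> h i j \<le> h i (j - 1) + 1"
  using facet_inequalities_rows[OF facet_inequalities_transpose[OF assms]] by auto

lemma boundaryD:
  assumes "boundary k h"
  shows "i \<le> k \<Longrightarrow> h i 0 = 0" "i \<le> k \<Longrightarrow> h i 1 = 0" "i \<le> k \<Longrightarrow> h i k = real (i div 2)"
    "j \<le> k \<Longrightarrow> h 0 j = 0" "j \<le> k \<Longrightarrow> h 1 j = 0" "j \<le> k \<Longrightarrow> h k j = real (j div 2)"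
  using assms by (auto simp: boundary_def)

lemma boundary_unit_step:
  assumes "boundary k h" "i \<in> {1..k}" "j \<le> k" "i = 1 \<or> j \<le> 1 \<or> j = k"
  shows "unit_step (h (i - 1) j) (h i j)"
proof -
  have "i - 1 \<le> k" "i \<le> k" using assms(2) by auto
  moreover have "j = 0 \<or> j = 1 \<or> j = k \<or> i = 1" using assms(4) by auto
  ultimately show ?thesis
    using boundaryD[OF assms(1)] assms(2,3) half_increment[of i]
    by (auto simp: unit_step_def)
qed

text \<open>A monotonicity condition missing from the list follows by a detour through neighbouring
  positions, with listed inequalities for the moves and prescribed values to close the gap.\<close>

lemma facet_inequalities_row_mono:
  assumes k: "4 \<le> k" and bd: "boundary k h" and ineq: "facet_inequalities k h"
    and i: "i \<in> {1..k}" and j: "j \<le> k"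
  shows "h (i - 1) j \<le> h i j"
proof -
  note R = facet_inequalities_rows[OF ineq] and C = facet_inequalities_cols[OF k bd ineq]
  note bd' = boundaryD[OF bd]
  have half: "real (l div 2) = real ((l - 1) div 2) + of_bool (even l)" if "1 \<le> l" for l
    using half_increment[OF that] .
  have le: "i - 1 \<le> k" "i \<le> k" "j - 1 \<le> k" using i j by auto
  consider "i = 1 \<or> j \<le> 1 \<or> j = k" | "i = 2" "2 \<le> j" "j < k"
    | "3 \<le> i" "i < k" "2 \<le> j" "j < k" "even i \<longrightarrow> j \<noteq> k - 1"
    | "3 \<le> i" "i < k" "even i" "j = k - 1"
    | "i = k" "odd j" "3 \<le> j" "j < k"
    | "i = k" "j = 2"
    | "i = k" "even j" "4 \<le> j" "j < k"
  proof (cases "i = 1 \<or> j \<le> 1 \<or> j = k")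
    case inner: False
    then have ij: "2 \<le> i" "i \<le> k" "2 \<le> j" "j < k" using i j by auto
    show ?thesis
    proof (cases "i = k")
      case True
      then show ?thesis
        using ij that(5,6,7) by (cases "odd j"; cases "j = 2 \<or> j = 3") auto
    next
      case False
      then have "i < k" using ij by simp
      consider "i = 2" | "3 \<le> i" "even i" "j = k - 1" | "3 \<le> i" "even i \<longrightarrow> j \<noteq> k - 1"
        using ij by linarith
      then show ?thesis
      proof cases
        case 1
        show ?thesis by (rule that(2)) (use 1 ij in simp_all)
      next
        case 2
        show ?thesis by (rule that(4)) (use 2 \<open>i < k\<close> in simp_all)
      next
        case 3
        show ?thesis by (rule that(3)) (use 3 \<open>i < k\<close> ij in simp_all)
      qed
    qed
  qed (rule that(1))
  then show ?thesis
  proof cases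
    case 1
    then show ?thesis
      using boundary_unit_step[OF bd i j] by (simp add: unit_step_def)
  next
    case 2
    \<comment> \<open>The listed row inequality at (2, 2) gives
      \<open>h 2 2 \<ge> h 1 2 = 0\<close>; from there row 2 grows by listed column
      inequalities.\<close>
    have "0 \<le> h 2 j"
      using 2(2,3)
    proof (induction j rule: dec_induct)
      case base
      show ?case using R(1)[of 2 2] bd'(5)[of 2] k by (simp add: row_zero_indices_def)
    next
      case (step l)
      then have "(Suc l, 2) \<in> row_zero_indices k"
        using k by (cases "even l") (auto simp: row_zero_indices_def)
      then show ?case using C(1)[of "Suc l" 2] step by simp
    qed
    then show ?thesis using 2 bd'(5)[of j] by simp
  next
    case 3
    then have "(i, j) \<in> row_zero_indices k" by (auto simp: row_zero_indices_def)
    then show ?thesis by (rule R(1))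
  next
    \<comment> \<open>The detour uses the last column: \<open>h i (k - 1) \<ge> h i k - 1 = h (i -
      1) k \<ge> h (i - 1) (k - 1)\<close>, the middle equality because i is even.\<close>
    case 4
    then have "4 \<le> i" "odd (i - 1)" by presburger+
    with 4 have "(k, i) \<in> row_one_indices k" "(k, i - 1) \<in> row_zero_indices k"
      by (auto simp: row_one_indices_def row_zero_indices_def)
    then show ?thesis
      using C(2)[of k i] C(1)[of k "i - 1"] bd'(3)[OF le(1)] bd'(3)[OF le(2)] half[of i] 4 by simp
  next
    case 5
    then have "(i, j) \<in> row_zero_indices k" by (auto simp: row_zero_indices_def)
    then show ?thesis by (rule R(1))
  next
    \<comment> \<open>Column 3 ends with the same value as column 2:
      \<open>h (k - 1) 2 \<le> h (k - 1) 3 \<le> h k 3 = 1 = h k 2\<close>.\<close>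
    case 6
    have "(k, 3) \<in> row_zero_indices k" "(3, k - 1) \<in> row_zero_indices k"
      using k by (auto simp: row_zero_indices_def)
    then show ?thesis
      using R(1)[of k 3] C(1)[of 3 "k - 1"] bd'(6)[of 2] bd'(6)[of 3] 6 k by simp
  next
    \<comment> \<open>Here \<open>h (k - 1) j \<le> h (k - 1) (j - 1) + 1 \<le> h k (j - 1) + 1 = h
      k j\<close>, as j is even.\<close>
    case 7
    then have "(j, k - 1) \<in> row_one_indices k" "(k, j - 1) \<in> row_zero_indices k"
      by (auto simp: row_one_indices_def row_zero_indices_def)
    then show ?thesis
      using C(2)[of j "k - 1"] R(1)[of k "j - 1"] bd'(6)[OF j] bd'(6)[OF le(3)] half[of j] 7 by simp
  qed
qed

lemma facet_inequalities_imp_unit_step: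
  assumes k: "4 \<le> k" and bd: "boundary k h" and ineq: "facet_inequalities k h"
    and i: "i \<in> {1..k}" and j: "j \<le> k"
  shows "unit_step (h (i - 1) j) (h i j)"
proof -
  note R = facet_inequalities_rows[OF ineq] and C = facet_inequalities_cols[OF k bd ineq]
  note bd' = boundaryD[OF bd]
  have half: "real (l div 2) = real ((l - 1) div 2) + of_bool (even l)" if "1 \<le> l" for l
    using half_increment[OF that] .
  have le: "i - 1 \<le> k" "i \<le> k" "j - 1 \<le> k" using i j by auto
  have row: "h a b \<le> h a' b" if "a \<le> a'" "a' \<le> k" "b \<le> k" for a a' b
    using that(1,2)
  proof (induction a' rule: dec_induct)
    case (step l)
    then show ?case
      using facet_inequalities_row_mono[OF k bd ineq, of "Suc l" b] that(3) by auto
  qed simp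
  have col: "h a b \<le> h a b'" if "b \<le> b'" "b' \<le> k" "a \<le> k" for a b b'
    using that(1,2)
  proof (induction b' rule: dec_induct)
    case (step l)
    then show ?case
      using facet_inequalities_row_mono[OF k boundary_transpose[OF bd]
          facet_inequalities_transpose[OF k bd ineq], of "Suc l" a] that(3) by auto
  qed simp
  have nonneg: "0 \<le> h (i - 1) j"
    using row[of 0 "i - 1" j] bd'(4)[of j] i j by auto
  consider "i = 1 \<or> j \<le> 1 \<or> j = k" | "2 \<le> i" "i \<le> 3" | "2 \<le> j" "j \<le> 3"
    | "4 \<le> i" "i < k" "4 \<le> j" "j < k" "odd i \<longrightarrow> j \<noteq> k - 1"
    | "5 \<le> i" "i < k" "odd i" "j = k - 1"
    | "i = k" "even j" "4 \<le> j" "j < k"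
    | "i = k" "odd j" "5 \<le> j" "j < k"
  proof (cases "i = 1 \<or> j \<le> 1 \<or> j = k")
    case inner: False
    then have ij: "2 \<le> i" "i \<le> k" "2 \<le> j" "j < k" using i j by auto
    have five: "odd l \<Longrightarrow> 4 \<le> l \<Longrightarrow> 5 \<le> l" for l :: nat by presburger
    consider "i \<le> 3" | "j \<le> 3" | "4 \<le> i" "4 \<le> j" by linarith
    then show ?thesis
    proof cases
      case 3
      show ?thesis
      proof (cases "i = k")
        case True
        then show ?thesis
          using ij 3 five[of j] that(6,7) by (cases "odd j") auto
      next
        case False
        then have "i < k" using ij by simp
        show ?thesis
        proof (cases "odd i \<and> j = k - 1")
          case True
          show ?thesis by (rule that(5)) (use True five[of i] 3 \<open>i < k\<close> in simp_all)
        next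
          case False
          show ?thesis by (rule that(4)) (use False 3 \<open>i < k\<close> ij in auto)
        qed
      qed
    qed (use ij that(2,3) in auto)
  qed (rule that(1))
  then have "h i j \<le> h (i - 1) j + 1"
  proof cases
    case 1
    then show ?thesis
      using boundary_unit_step[OF bd i j] by (simp add: unit_step_def)
  next
    \<comment> \<open>In rows 2 and 3 the whole range is [0,1], since
      \<open>h i k = i div 2 = 1\<close>. This is why the lists for the value 1 start at 4.\<close>
    case 2
    then have "i = 2 \<or> i = 3" by auto
    then show ?thesis
      using col[of j k i] bd'(3)[of i] nonneg i j by auto
  next
    case 3
    then have "j = 2 \<or> j = 3" by auto
    then show ?thesis
      using row[of i k j] bd'(6)[of j] nonneg i j by auto
  next
    case 4
    then have "(i, j) \<in> row_one_indices k" by (auto simp: row_one_indices_def)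
    then show ?thesis by (rule R(2))
  next
    \<comment> \<open>For odd i the last column does not grow: \<open>h i (k - 1) \<le> h i k = h (i
      - 1) k \<le> h (i - 1) (k - 1) + 1\<close>.\<close>
    case 5
    then have "(k, i - 1) \<in> row_one_indices k"
      by (auto simp: row_one_indices_def)
    then show ?thesis
      using C(2)[of k "i - 1"] col[of "k - 1" k i] bd'(3)[OF le(1)] bd'(3)[OF le(2)] half[of i] 5 by simp
  next
    case 6
    then have "(i, j) \<in> row_one_indices k" by (auto simp: row_one_indices_def)
    then show ?thesis by (rule R(2))
  next
    \<comment> \<open>For odd j the last row does not grow: \<open>h k j = h k (j - 1) \<le> h (k -
      1) (j - 1) + 1 \<le> h (k - 1) j + 1\<close>.\<close>
    case 7
    then have "(k, j - 1) \<in> row_one_indices k"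
      by (auto simp: row_one_indices_def)
    then show ?thesis
      using R(2)[of k "j - 1"] col[of "j - 1" j "k - 1"] bd'(6)[OF j] bd'(6)[OF le(3)] half[of j] 7
      by simp
  qed
  then show ?thesis
    using facet_inequalities_row_mono[OF k bd ineq i j] by (simp add: unit_step_def)
qed

lemma Row_Eq_facet_equation_bounds:
  "4 \<le> k \<Longrightarrow> Row_Eq i j c \<in> facet_equations k \<Longrightarrow> i \<in> {1..k} \<and> j \<in> {1..k} \<and> (c = 0 \<or> c = 1)"
  by (auto simp: Row_Eq_facet_equations row_zero_indices_def row_one_indices_def)

lemma facet_equation_cases:
  assumes "4 \<le> k" "e \<in> facet_equations k"
  obtains i j c where "i \<in> {1..k}" "j \<in> {1..k}" "c = 0 \<or> c = 1" "e = Row_Eq i j c \<or> e = Col_Eq i j c"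
proof (cases e)
  case (Row_Eq i j c)
  then show ?thesis
    using that[of i j c] Row_Eq_facet_equation_bounds[of k i j c] assms by blast
next
  case (Col_Eq i j c)
  then show ?thesis
    using that[of i j c] Row_Eq_facet_equation_bounds[of k j i c] assms
      Col_Eq_facet_equations[of k i j c] by blast
qed

lemma corner_system_iff_facet_inequalities:
  assumes k: "4 \<le> k"
  shows "corner_system k h \<longleftrightarrow> boundary k h \<and> facet_inequalities k h"
proof
  assume sys: "corner_system k h"
  have "lhs e h \<le> rhs e" if "e \<in> facet_equations k" for e
    using sys
    by (cases rule: facet_equation_cases[OF k that]) (auto simp: corner_system_def unit_step_def algebra_simps)
  then show "boundary k h \<and> facet_inequalities k h"
    using sys by (simp add: corner_system_def facet_inequalities_def)
next
  assume h: "boundary k h \<and> facet_inequalities k h"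
  show "corner_system k h"
    unfolding corner_system_def
  proof (intro conjI ballI)
    fix i j assume ij: "i \<in> {1..k}" "j \<in> {1..k}"
    show "unit_step (h (i - 1) j) (h i j)"
      using facet_inequalities_imp_unit_step[OF k, of h i j] h ij by simp
    show "unit_step (h i (j - 1)) (h i j)"
      using facet_inequalities_imp_unit_step[OF k, of "\<lambda>i j. h j i" j i]
        boundary_transpose[of k h] facet_inequalities_transpose[OF k, of h] h ij by simp
  qed (use h in simp)
qed

section \<open>Irredundancy of the facet inequalities\<close>

text \<open>The greatest and the least height function with the prescribed boundary values.\<close>

definition upper :: "nat \<Rightarrow> nat \<Rightarrow> int" where
  "upper i j = min (int i div 2) (int j div 2)"

definition lower :: "nat \<Rightarrow> nat \<Rightarrow> nat \<Rightarrow> int" where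
  "lower k i j = max 0 (max (int i div 2 + int j - int k) (int j div 2 + int i - int k))"

text \<open>Since \<open>lower\<close> and \<open>upper\<close> agree on the boundary, truncation
  repairs the boundary values of an arbitrary \<open>g\<close>, and it leaves \<open>g\<close> alone
  wherever it already lies between the two.\<close>

definition clamped :: "nat \<Rightarrow> (nat \<Rightarrow> nat \<Rightarrow> int) \<Rightarrow> nat \<Rightarrow> nat \<Rightarrow> int" where
  "clamped k g i j = min (upper i j) (max (lower k i j) (g i j))"

lemma clamped_eq: "lower k i j \<le> g i j \<Longrightarrow> g i j \<le> upper i j \<Longrightarrow> clamped k g i j = g i j"
  by (simp add: clamped_def)

definition int_step :: "int \<Rightarrow> int \<Rightarrow> bool" where
  "int_step a b \<longleftrightarrow> a \<le> b \<and> b \<le> a + 1"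

lemma unit_step_of_int [simp]: "unit_step (of_int a) (of_int b) \<longleftrightarrow> int_step a b"
  unfolding unit_step_def int_step_def by linarith

lemma int_step_min: "int_step a b \<Longrightarrow> int_step c d \<Longrightarrow> int_step (min a c) (min b d)"
  and int_step_max: "int_step a b \<Longrightarrow> int_step c d \<Longrightarrow> int_step (max a c) (max b d)"
  by (auto simp: int_step_def)

lemma upper_step:
  assumes "1 \<le> i"
  shows "int_step (upper (i - 1) j) (upper i j)" "int_step (upper j (i - 1)) (upper j i)"
proof -
  obtain n where n: "i = Suc n" using assms by (cases i) auto
  show "int_step (upper (i - 1) j) (upper i j)" "int_step (upper j (i - 1)) (upper j i)"
    unfolding upper_def n diff_Suc_1 by (intro int_step_min; unfold int_step_def; presburger)+
qed

lemma lower_step: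
  assumes "1 \<le> i"
  shows "int_step (lower k (i - 1) j) (lower k i j)" "int_step (lower k j (i - 1)) (lower k j i)"
proof -
  obtain n where n: "i = Suc n" using assms by (cases i) auto
  show "int_step (lower k (i - 1) j) (lower k i j)" "int_step (lower k j (i - 1)) (lower k j i)"
    unfolding lower_def n diff_Suc_1 by (intro int_step_max; unfold int_step_def; presburger)+
qed

text \<open>Minimum and maximum preserve unit steps. The claim is made for each step separately, so
  that a broken step of \<open>g\<close> spoils only the same step of the truncation.\<close>

lemma clamped_step:
  assumes "1 \<le> i"
  shows "int_step (g (i - 1) j) (g i j) \<Longrightarrow> int_step (clamped k g (i - 1) j) (clamped k g i j)"
    "int_step (g j (i - 1)) (g j i) \<Longrightarrow> int_step (clamped k g j (i - 1)) (clamped k g j i)"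
  unfolding clamped_def
  using upper_step[OF assms] lower_step[OF assms] by (simp_all add: int_step_min int_step_max)

lemma upper_boundary:
  assumes "1 \<le> k"
  shows "boundary k (\<lambda>i j. of_int (upper i j))"
proof -
  have half: "int i div 2 \<le> int k div 2" if "i \<le> k" for i
    using that by (intro zdiv_mono1) auto
  have real: "real_of_int (int i div 2) = real (i div 2)" for i
  proof -
    have "int i div 2 = int (i div 2)" by presburger
    then show ?thesis by (simp only: of_int_of_nat_eq)
  qed
  show ?thesis
    using assms unfolding boundary_def upper_def
    by (auto simp: half real min_absorb1 min_absorb2)
qed

text \<open>Going back k - j unit steps from the value i div 2 in the last column loses at most k -
  j, which explains the terms of \<open>lower\<close>. On the boundary this bound is
  attained.\<close>

lemma lower_eq_upper:
  assumes "1 \<le> k" "i \<le> k" "j \<le> 1 \<or> j = k"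
  shows "lower k i j = upper i j" "lower k j i = upper j i"
proof -
  have a: "int i div 2 \<le> int k div 2" "int k div 2 + int i - int k \<le> int i div 2"
    "int i div 2 \<le> int k" "0 \<le> int i div 2" "int i div 2 + 1 \<le> int k"
    using assms(1,2) by presburger+
  consider "j = 0" | "j = 1" | "j = k" using assms(3) by linarith
  then show "lower k i j = upper i j" "lower k j i = upper j i"
    using a assms(2) by (cases; simp add: lower_def upper_def; fail)+
qed

lemma boundary_of_int_cong:
  assumes "1 \<le> k"
    and "\<And>i j. i \<le> k \<Longrightarrow> j \<le> 1 \<or> j = k \<Longrightarrow> g i j = upper i j"
    and "\<And>i j. i \<le> k \<Longrightarrow> j \<le> 1 \<or> j = k \<Longrightarrow> g j i = upper j i"
  shows "boundary k (\<lambda>i j. of_int (g i j))"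
  using upper_boundary[OF assms(1)] assms(2,3) unfolding boundary_def by simp

lemma lower_boundary: "1 \<le> k \<Longrightarrow> boundary k (\<lambda>i j. of_int (lower k i j))"
  by (intro boundary_of_int_cong lower_eq_upper)

lemma clamped_boundary: "1 \<le> k \<Longrightarrow> boundary k (\<lambda>i j. of_int (clamped k g i j))"
  by (intro boundary_of_int_cong) (auto simp: clamped_def lower_eq_upper)

lemma corner_system_upper: "1 \<le> k \<Longrightarrow> corner_system k (\<lambda>i j. of_int (upper i j))"
  by (simp add: corner_system_def upper_boundary upper_step[simplified])

lemma corner_system_lower: "1 \<le> k \<Longrightarrow> corner_system k (\<lambda>i j. of_int (lower k i j))"
  by (simp add: corner_system_def lower_boundary lower_step[simplified])

lemma corner_system_clamp:
  assumes "1 \<le> k" "\<And>i j. 1 \<le> i \<Longrightarrow> int_step (g (i - 1) j) (g i j) \<and> int_step (g j (i - 1)) (g j i)"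
  shows "corner_system k (\<lambda>i j. of_int (clamped k g i j))"
  using assms unfolding corner_system_def
  by (auto simp: clamped_boundary clamped_step[simplified])

text \<open>Row step \<open>(i, j)\<close> is exempt because it is to be violated.  The column steps \<open>(2, 2)\<close> and
  \<open>(k - 1, k)\<close> coincide with the row steps \<open>(2, 2)\<close> and \<open>(k, k - 1)\<close> on functions with the
  prescribed boundary values; the facet equations contain only the row version.\<close>

definition steps_except :: "nat \<Rightarrow> nat \<Rightarrow> nat \<Rightarrow> (nat \<Rightarrow> nat \<Rightarrow> int) \<Rightarrow> bool" where
  "steps_except k i j w \<longleftrightarrow> (\<forall>x\<in>{1..k}. \<forall>y\<in>{1..k}.
     ((x, y) \<noteq> (i, j) \<longrightarrow> int_step (w (x - 1) y) (w x y)) \<and>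
     ((x, y) \<noteq> (2, 2) \<longrightarrow> (x, y) \<noteq> (k - 1, k) \<longrightarrow> int_step (w x (y - 1)) (w x y)))"

lemma steps_except_clamp:
  assumes "\<And>x y. 1 \<le> x \<Longrightarrow> (x, y) \<noteq> (i, j) \<Longrightarrow> int_step (g (x - 1) y) (g x y)"
    "\<And>x y. 1 \<le> y \<Longrightarrow> int_step (g x (y - 1)) (g x y)"
  shows "steps_except k i j (clamped k g)"
  unfolding steps_except_def
proof (intro ballI conjI impI)
  fix x y assume xy: "x \<in> {1..k}" "y \<in> {1..k}"
  then show "int_step (clamped k g x (y - 1)) (clamped k g x y)"
    using assms(2)[of y x] by (intro clamped_step(2)) auto
  show "int_step (clamped k g (x - 1) y) (clamped k g x y)" if "(x, y) \<noteq> (i, j)"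
    using assms(1)[of x y] xy that by (intro clamped_step(1)) auto
qed

section \<open>Witnesses for row inequalities in rows 3 to k - 1\<close>

lemma interior_zero_gap:
  assumes "3 \<le> i" "i \<le> k - 1" "2 \<le> j" "j \<le> k - 1 - of_bool (even i)"
  shows "lower k i j + 1 \<le> upper (i - 1) j"
proof -
  define x y z where "x = int i" and "y = int j" and "z = int k"
  define p q r where "p = x div 2" and "q = y div 2" and "r = (x - 1) div 2"
  have i1: "int (i - 1) = x - 1" using assms by (simp add: x_def)
  have b: "3 \<le> x" "x \<le> z - 1" "2 \<le> y" "y \<le> z - 1" "even x \<longrightarrow> y \<le> z - 2"
    using assms by (auto simp: x_def y_def z_def split: if_splits)
  have pos: "1 \<le> r" "1 \<le> q"
    using b(1,3) unfolding q_def r_def by presburger+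
  have half: "even x \<longrightarrow> x = 2 * p \<and> x = 2 * r + 2" "odd x \<longrightarrow> x = 2 * p + 1 \<and> x = 2 * r + 1"
    "y \<le> 2 * q + 1" "2 * q \<le> y"
    unfolding p_def q_def r_def by presburger+
  \<comment> \<open>The parity in the index range originates here: the first inequality says y \<le>
    z - 2 for even x, where p = r + 1, but only y \<le> z - 1 for odd x, where p = r.\<close>
  have "p + y - z + 1 \<le> r \<and> p + y - z + 1 \<le> q \<and> q + x - z + 1 \<le> r \<and> q + x - z + 1 \<le> q"
  proof (cases "even x")
    case True
    then have e: "x = 2 * p" "x = 2 * r + 2" "y \<le> z - 2" using half(1) b(5) by auto
    then show ?thesis using e half(3,4) b(2) by linarith
  next
    case False
    then have e: "x = 2 * p + 1" "x = 2 * r + 1" using half(2) by auto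
    then show ?thesis using e half(3,4) b(2,4) by linarith
  qed
  moreover have "lower k i j = max 0 (max (p + y - z) (q + x - z))" "upper (i - 1) j = min r q"
    unfolding lower_def upper_def i1 by (simp_all add: p_def q_def r_def x_def y_def z_def)
  ultimately show ?thesis using pos by (simp add: max_def min_def)
qed

lemma interior_one_gap:
  assumes "4 \<le> i" "i \<le> k - 1" "4 \<le> j" "j \<le> k - 1 - of_bool (odd i)"
  shows "lower k (i - 1) j + 2 \<le> upper i j"
proof -
  define x y z where "x = int i" and "y = int j" and "z = int k"
  define p q r where "p = x div 2" and "q = y div 2" and "r = (x - 1) div 2"
  have i1: "int (i - 1) = x - 1" using assms by (simp add: x_def)
  have b: "4 \<le> x" "x \<le> z - 1" "4 \<le> y" "y \<le> z - 1" "odd x \<longrightarrow> y \<le> z - 2"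
    using assms by (auto simp: x_def y_def z_def split: if_splits)
  have pos: "2 \<le> p" "2 \<le> q"
    using b(1,3) unfolding p_def q_def by presburger+
  have half: "even x \<longrightarrow> x = 2 * p \<and> x = 2 * r + 2" "odd x \<longrightarrow> x = 2 * p + 1 \<and> x = 2 * r + 1"
    "y \<le> 2 * q + 1" "2 * q \<le> y"
    unfolding p_def q_def r_def by presburger+
  \<comment> \<open>Now the parities are exchanged: y \<le> z - 1 suffices for even x, while odd x
    requires y \<le> z - 2.\<close>
  have "r + y - z + 2 \<le> p \<and> r + y - z + 2 \<le> q \<and> q + (x - 1) - z + 2 \<le> p \<and> q + (x - 1) - z + 2 \<le> q"
  proof (cases "even x")
    case True
    then have e: "x = 2 * p" "x = 2 * r + 2" using half(1) by auto
    then show ?thesis using e half(3,4) b(2,4) by linarith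
  next
    case False
    then have e: "x = 2 * p + 1" "x = 2 * r + 1" "y \<le> z - 2" using half(2) b(5) by auto
    then show ?thesis using e half(3,4) b(2) by linarith
  qed
  moreover have "lower k (i - 1) j = max 0 (max (r + y - z) (q + (x - 1) - z))" "upper i j = min p q"
    unfolding lower_def upper_def i1 by (simp_all add: p_def q_def r_def x_def y_def z_def)
  ultimately show ?thesis using pos by (simp add: max_def min_def)
qed

lemma interior_zero_witness:
  assumes "3 \<le> i" "i \<le> k - 1" "2 \<le> j" "j \<le> k - 1 - of_bool (even i)"
  shows "\<exists>w. boundary k (\<lambda>i j. of_int (w i j)) \<and> w i j < w (i - 1) j \<and> steps_except k i j w"
    and "\<exists>s. corner_system k (\<lambda>i j. of_int (s i j)) \<and> s (i - 1) j < s i j"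
proof -
  define m where "m = lower k i j"
  have k: "1 \<le> k" and ni: "i \<noteq> 0" using assms by auto
  have "lower k (i - 1) j \<le> m" "upper (i - 1) j \<le> upper i j"
    using lower_step(1)[of i k j] upper_step(1)[of i j] assms by (auto simp: m_def int_step_def)
  moreover have "m + 1 \<le> upper (i - 1) j"
    using interior_zero_gap[OF assms] by (simp add: m_def)
  ultimately have m: "lower k (i - 1) j \<le> m" "m + 1 \<le> upper (i - 1) j" "m + 1 \<le> upper i j" "lower k i j \<le> m"
    by (auto simp: m_def)
  \<comment> \<open>The plane is split into level m up to column j and level m + 1 beyond it, and
    the point (i - 1, j) is moved to the upper level. Only the row step from this point down to (i,
    j) goes wrong. The gap lemma ensures that truncation keeps both values.\<close>
  define g where "g x y = m + of_bool (j < y \<or> x = i - 1 \<and> y = j)" for x y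
  have gv: "g i j = m" "g (i - 1) j = m + 1"
    using ni by (auto simp: g_def)
  have "clamped k g i j = m" "clamped k g (i - 1) j = m + 1"
    using m clamped_eq[of k i j g] clamped_eq[of k "i - 1" j g] gv by simp_all
  moreover have "steps_except k i j (clamped k g)"
    by (rule steps_except_clamp) (use assms in \<open>auto simp: g_def int_step_def\<close>)
  ultimately show "\<exists>w. boundary k (\<lambda>i j. of_int (w i j)) \<and> w i j < w (i - 1) j \<and> steps_except k i j w"
    using clamped_boundary[OF k, of g] by (intro exI[of _ "clamped k g"]) simp
  \<comment> \<open>A jump exactly between rows i - 1 and i makes the inequality strict.\<close>
  define f where "f x y = m + of_bool (i \<le> x)" for x y :: nat
  have fv: "f i j = m + 1" "f (i - 1) j = m"
    using ni by (auto simp: f_def)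
  have "clamped k f i j = m + 1" "clamped k f (i - 1) j = m"
    using m clamped_eq[of k i j f] clamped_eq[of k "i - 1" j f] fv by simp_all
  moreover have "corner_system k (\<lambda>i j. of_int (clamped k f i j))"
    by (rule corner_system_clamp[OF k]) (auto simp: f_def int_step_def)
  ultimately show "\<exists>s. corner_system k (\<lambda>i j. of_int (s i j)) \<and> s (i - 1) j < s i j"
    by (intro exI[of _ "clamped k f"]) simp
qed

lemma interior_one_witness:
  assumes "4 \<le> i" "i \<le> k - 1" "4 \<le> j" "j \<le> k - 1 - of_bool (odd i)"
  shows "\<exists>w. boundary k (\<lambda>i j. of_int (w i j)) \<and> w (i - 1) j + 1 < w i j \<and> steps_except k i j w"
    and "\<exists>s. corner_system k (\<lambda>i j. of_int (s i j)) \<and> s i j < s (i - 1) j + 1"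
proof -
  define m where "m = lower k (i - 1) j"
  have k: "1 \<le> k" and ni: "i \<noteq> 0" using assms by auto
  have "lower k i j \<le> m + 1" "upper i j \<le> upper (i - 1) j + 1"
    using lower_step(1)[of i k j] upper_step(1)[of i j] assms by (auto simp: m_def int_step_def)
  moreover have "m + 2 \<le> upper i j"
    using interior_one_gap[OF assms] by (simp add: m_def)
  ultimately have m: "lower k (i - 1) j \<le> m" "m + 1 \<le> upper (i - 1) j" "m + 2 \<le> upper i j" "lower k i j \<le> m + 1"
    by (auto simp: m_def)
  \<comment> \<open>Above row i the levels left of, in and right of column j are 0, 0, 1; from row i
    on they are 1, 2, 2. Every step is 0 or 1 except the one from 0 to 2 in column j.\<close>
  define g where "g x y = m + (if y < j then of_bool (i \<le> x)
    else if y = j then 2 * of_bool (i \<le> x) else 1 + of_bool (i \<le> x))" for x y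
  have gv: "g i j = m + 2" "g (i - 1) j = m"
    using ni by (auto simp: g_def)
  have "clamped k g i j = m + 2" "clamped k g (i - 1) j = m"
    using m clamped_eq[of k i j g] clamped_eq[of k "i - 1" j g] gv by simp_all
  moreover have "steps_except k i j (clamped k g)"
    by (rule steps_except_clamp) (use assms in \<open>auto simp: g_def int_step_def\<close>)
  ultimately show "\<exists>w. boundary k (\<lambda>i j. of_int (w i j)) \<and> w (i - 1) j + 1 < w i j \<and> steps_except k i j w"
    using clamped_boundary[OF k, of g] by (intro exI[of _ "clamped k g"]) simp
  \<comment> \<open>The level m + 1 is admissible at both positions, so the step there is 0 and
    below its bound.\<close>
  define f where "f x y = m + 1" for x y :: nat
  have fv: "f i j = m + 1" "f (i - 1) j = m + 1"
    using ni by (auto simp: f_def)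
  have "clamped k f i j = m + 1" "clamped k f (i - 1) j = m + 1"
    using m clamped_eq[of k i j f] clamped_eq[of k "i - 1" j f] fv by simp_all
  moreover have "corner_system k (\<lambda>i j. of_int (clamped k f i j))"
    by (rule corner_system_clamp[OF k]) (auto simp: f_def int_step_def)
  ultimately show "\<exists>s. corner_system k (\<lambda>i j. of_int (s i j)) \<and> s i j < s (i - 1) j + 1"
    by (intro exI[of _ "clamped k f"]) simp
qed

section \<open>Witnesses for row inequalities in row k and at (2, 2)\<close>

lemma upper_near_edge:
  shows "2 * q \<le> k - 1 \<Longrightarrow> upper (k - 1) (2 * q) = int q"
    and "2 * q + 1 \<le> k - 1 \<Longrightarrow> upper (k - 1) (2 * q + 1) = int q"
    and "2 * q + 1 \<le> k - 1 \<Longrightarrow> upper (k - 2) (2 * q + 1) = int q"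
    and "2 * q \<le> k \<Longrightarrow> upper k (2 * q) = int q"
    and "2 * q + 1 \<le> k \<Longrightarrow> upper k (2 * q + 1) = int q"
proof -
  have half: "int (2 * q) div 2 = int q" "int (2 * q + 1) div 2 = int q"
    by simp_all
  have le: "int q \<le> int m div 2" if "2 * q \<le> m" for m
    using that by presburger
  show "2 * q \<le> k - 1 \<Longrightarrow> upper (k - 1) (2 * q) = int q"
    "2 * q + 1 \<le> k - 1 \<Longrightarrow> upper (k - 1) (2 * q + 1) = int q"
    "2 * q + 1 \<le> k - 1 \<Longrightarrow> upper (k - 2) (2 * q + 1) = int q"
    "2 * q \<le> k \<Longrightarrow> upper k (2 * q) = int q"
    "2 * q + 1 \<le> k \<Longrightarrow> upper k (2 * q + 1) = int q"
    unfolding upper_def half using le[of "k - 1"] le[of "k - 2"] le[of k] by auto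
qed

lemma lower_near_edge:
  assumes "1 \<le> q"
  shows "2 * q \<le> k - 1 \<Longrightarrow> lower k (k - 1) (2 * q) = int q - 1"
    and "2 * q + 1 \<le> k - 1 \<Longrightarrow> lower k (k - 1) (2 * q + 1) = int q - 1"
    and "2 * q \<le> k - 1 \<Longrightarrow> 2 \<le> q \<Longrightarrow> lower k (k - 2) (2 * q) = int q - 2"
    and "2 * q \<le> k \<Longrightarrow> lower k k (2 * q) = int q"
    and "2 * q + 1 \<le> k \<Longrightarrow> lower k k (2 * q + 1) = int q"
proof -
  have half: "int (2 * q) div 2 = int q" "int (2 * q + 1) div 2 = int q"
    by simp_all
  show "lower k (k - 1) (2 * q) = int q - 1" if "2 * q \<le> k - 1"
  proof -
    have "(int k - 1) div 2 + 2 * int q - int k \<le> int q - 1"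
      using that by presburger
    then show ?thesis unfolding lower_def half using assms that by (simp add: of_nat_diff)
  qed
  show "lower k (k - 1) (2 * q + 1) = int q - 1" if "2 * q + 1 \<le> k - 1"
  proof -
    have "(int k - 1) div 2 + (2 * int q + 1) - int k \<le> int q - 1"
      using that by presburger
    then show ?thesis unfolding lower_def half using assms that by (simp add: of_nat_diff)
  qed
  show "lower k (k - 2) (2 * q) = int q - 2" if "2 * q \<le> k - 1" "2 \<le> q"
  proof -
    have "(int k - 2) div 2 + 2 * int q - int k \<le> int q - 2"
      using that by presburger
    then show ?thesis unfolding lower_def half using that by (simp add: of_nat_diff)
  qed
  show "lower k k (2 * q) = int q" if "2 * q \<le> k"
  proof -
    have "int k div 2 + 2 * int q - int k \<le> int q"
      using that by presburger
    then show ?thesis unfolding lower_def half by simp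
  qed
  show "lower k k (2 * q + 1) = int q" if "2 * q + 1 \<le> k"
  proof -
    have "int k div 2 + (2 * int q + 1) - int k \<le> int q"
      using that by presburger
    then show ?thesis unfolding lower_def half by simp
  qed
qed

text \<open>Changing a step function at the single point (a, b) affects four steps only; the guards
  in the hypotheses are the steps that \<open>steps_except\<close> exempts.\<close>

lemma steps_exceptI:
  assumes step: "\<And>x y. 1 \<le> x \<Longrightarrow> int_step (g (x - 1) y) (g x y) \<and> int_step (g y (x - 1)) (g y x)"
    and near: "1 \<le> a" "1 \<le> b"
      "(a, b) \<noteq> (i, j) \<Longrightarrow> int_step (g (a - 1) b) (g a b + d)"
      "(a + 1, b) \<noteq> (i, j) \<Longrightarrow> int_step (g a b + d) (g (a + 1) b)"
      "(a, b) \<noteq> (2, 2) \<Longrightarrow> int_step (g a (b - 1)) (g a b + d)"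
      "(a, b + 1) \<noteq> (k - 1, k) \<Longrightarrow> int_step (g a b + d) (g a (b + 1))"
  shows "steps_except k i j (\<lambda>x y. g x y + (if x = a \<and> y = b then d else 0))"
  unfolding steps_except_def
proof (intro ballI conjI impI)
  fix x y assume xy: "x \<in> {1..k}" "y \<in> {1..k}"
  let ?w = "\<lambda>x y. g x y + (if x = a \<and> y = b then d else 0)"
  show "int_step (?w (x - 1) y) (?w x y)" if "(x, y) \<noteq> (i, j)"
  proof (cases "y = b \<and> (x = a \<or> x = a + 1)")
    case True
    then show ?thesis using near that by auto
  next
    case False
    then have "\<not> (x = a \<and> y = b)" "\<not> (x - 1 = a \<and> y = b)" using xy by auto
    then show ?thesis using step[of x y] xy by auto
  qed
  show "int_step (?w x (y - 1)) (?w x y)" if "(x, y) \<noteq> (2, 2)" "(x, y) \<noteq> (k - 1, k)"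
  proof (cases "x = a \<and> (y = b \<or> y = b + 1)")
    case True
    then show ?thesis using near that by auto
  next
    case False
    then have "\<not> (x = a \<and> y = b)" "\<not> (x = a \<and> y - 1 = b)" using xy by auto
    then show ?thesis using step[of y x] xy by auto
  qed
qed

lemma boundary_bump:
  assumes "1 \<le> k" "2 \<le> a" "a < k" "2 \<le> b" "b < k"
    and "\<And>i j. i \<le> k \<Longrightarrow> j \<le> 1 \<or> j = k \<Longrightarrow> g i j = upper i j \<and> g j i = upper j i"
  shows "boundary k (\<lambda>x y. of_int (g x y + (if x = a \<and> y = b then d else 0)))"
  by (rule boundary_of_int_cong) (use assms in auto)

lemma edge_zero_witness:
  assumes "3 \<le> j" "j \<le> k - 1" "odd j"
  shows "\<exists>w. boundary k (\<lambda>i j. of_int (w i j)) \<and> w k j < w (k - 1) j \<and> steps_except k k j w"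
    and "\<exists>s. corner_system k (\<lambda>i j. of_int (s i j)) \<and> s (k - 1) j < s k j"
proof -
  obtain q where j: "j = 2 * q + 1" using \<open>odd j\<close> by (rule oddE)
  have q: "1 \<le> q" "2 * q + 1 \<le> k - 1" and k: "4 \<le> k" using assms j by auto
  have u: "upper (k - 1) j = int q" "upper (k - 2) j = int q" "upper k j = int q"
    "upper (k - 1) (j - 1) = int q"
    using upper_near_edge[where q = q and k = k] q j by auto
  have u': "upper (k - 1) (j + 1) = int q + 1" if "j + 1 \<noteq> k"
    using upper_near_edge(1)[of "q + 1" k] that q j by auto
  \<comment> \<open>For odd j, \<open>upper\<close> has the value q at both (k - 1, j) and (k, j).
    The latter is prescribed, so a descent requires exceeding \<open>upper\<close> at the
    former.\<close>
  define w where "w x y = upper x y + (if x = k - 1 \<and> y = j then 1 else 0)" for x y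
  have "steps_except k k j w"
    unfolding w_def
  proof (rule steps_exceptI)
    show "int_step (upper (x - 1) y) (upper x y) \<and> int_step (upper y (x - 1)) (upper y x)"
      if "1 \<le> x" for x y
      using upper_step[OF that] by simp
    have "k - 1 - 1 = k - 2" by simp
    then show "int_step (upper (k - 1 - 1) j) (upper (k - 1) j + 1)"
      "int_step (upper (k - 1) (j - 1)) (upper (k - 1) j + 1)"
      using u by (simp_all add: int_step_def)
    \<comment> \<open>If j + 1 < k, then j + 1 is even and \<open>upper\<close> has itself risen to
      q + 1. If j + 1 = k, the step is broken but exempt.\<close>
    show "int_step (upper (k - 1) j + 1) (upper (k - 1) (j + 1))" if "(k - 1, j + 1) \<noteq> (k - 1, k)"
      using u u' that by (simp add: int_step_def)
  qed (use k q j in auto)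
  moreover have "boundary k (\<lambda>i j. of_int (w i j))"
    unfolding w_def by (rule boundary_bump) (use k q j in auto)
  moreover have "w k j < w (k - 1) j"
    using u k by (simp add: w_def)
  ultimately show "\<exists>w. boundary k (\<lambda>i j. of_int (w i j)) \<and> w k j < w (k - 1) j \<and> steps_except k k j w"
    by blast
  have "lower k (k - 1) j < lower k k j"
    using lower_near_edge(2,5)[OF q(1), of k] q j by simp
  then show "\<exists>s. corner_system k (\<lambda>i j. of_int (s i j)) \<and> s (k - 1) j < s k j"
    using corner_system_lower[of k] k by (intro exI[of _ "lower k"]) simp
qed

lemma edge_one_witness:
  assumes "4 \<le> j" "j \<le> k - 1" "even j"
  shows "\<exists>w. boundary k (\<lambda>i j. of_int (w i j)) \<and> w (k - 1) j + 1 < w k j \<and> steps_except k k j w"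
    and "\<exists>s. corner_system k (\<lambda>i j. of_int (s i j)) \<and> s k j < s (k - 1) j + 1"
proof -
  obtain q where j: "j = 2 * q" using \<open>even j\<close> by (rule evenE)
  have q: "2 \<le> q" "2 * q \<le> k - 1" and k: "5 \<le> k" using assms j by auto
  have "j - 1 = 2 * (q - 1) + 1" using q j by simp
  then have l: "lower k (k - 1) j = int q - 1" "lower k (k - 2) j = int q - 2" "lower k k j = int q"
    "lower k (k - 1) (j - 1) = int q - 2"
    using lower_near_edge[of q k] lower_near_edge(2)[of "q - 1" k] q j by auto
  have l': "lower k (k - 1) (j + 1) = int q - 1" if "j + 1 \<noteq> k"
    using lower_near_edge(2)[of q k] that q j by auto
  \<comment> \<open>For even j, \<open>lower\<close> already makes the full step from q - 1 to the
    prescribed q; lowering its start by 1 produces a step of 2.\<close>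
  define w where "w x y = lower k x y + (if x = k - 1 \<and> y = j then - 1 else 0)" for x y
  have "steps_except k k j w"
    unfolding w_def
  proof (rule steps_exceptI)
    show "int_step (lower k (x - 1) y) (lower k x y) \<and> int_step (lower k y (x - 1)) (lower k y x)"
      if "1 \<le> x" for x y
      using lower_step[OF that] by simp
    have "k - 1 - 1 = k - 2" by simp
    then show "int_step (lower k (k - 1 - 1) j) (lower k (k - 1) j + - 1)"
      "int_step (lower k (k - 1) (j - 1)) (lower k (k - 1) j + - 1)"
      using l by (simp_all add: int_step_def)
    show "int_step (lower k (k - 1) j + - 1) (lower k (k - 1) (j + 1))" if "(k - 1, j + 1) \<noteq> (k - 1, k)"
      using l l' that by (simp add: int_step_def)
  qed (use k q j in auto)
  moreover have "boundary k (\<lambda>i j. of_int (w i j))"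
    unfolding w_def by (rule boundary_bump) (use k q j lower_eq_upper[of k] in auto)
  moreover have "w (k - 1) j + 1 < w k j"
    using l k by (simp add: w_def)
  ultimately show "\<exists>w. boundary k (\<lambda>i j. of_int (w i j)) \<and> w (k - 1) j + 1 < w k j \<and> steps_except k k j w"
    by blast
  have "upper k j < upper (k - 1) j + 1"
    using upper_near_edge(1,4)[of q k] q j by simp
  then show "\<exists>s. corner_system k (\<lambda>i j. of_int (s i j)) \<and> s k j < s (k - 1) j + 1"
    using corner_system_upper[of k] k by (intro exI[of _ upper]) simp
qed

lemma corner_zero_witness:
  assumes "4 \<le> k"
  shows "\<exists>w. boundary k (\<lambda>i j. of_int (w i j)) \<and> w 2 2 < w (2 - 1) 2 \<and> steps_except k 2 2 w"
    and "\<exists>s. corner_system k (\<lambda>i j. of_int (s i j)) \<and> s (2 - 1) 2 < s 2 2"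
proof -
  have l: "lower k 2 2 = 0" "lower k 3 2 = 0" "lower k 2 3 = 0" "lower k 1 2 = 0"
    using assms by (auto simp: lower_def)
  \<comment> \<open>The value -1 at (2, 2) lies below the zeros prescribed at (1, 2) and at (2, 1).
    It breaks the row step and the exempt column step there.\<close>
  define w where "w x y = lower k x y + (if x = 2 \<and> y = 2 then - 1 else 0)" for x y
  have "steps_except k 2 2 w"
    unfolding w_def
  proof (rule steps_exceptI)
    show "int_step (lower k (x - 1) y) (lower k x y) \<and> int_step (lower k y (x - 1)) (lower k y x)"
      if "1 \<le> x" for x y
      using lower_step[OF that] by simp
  qed (use l in \<open>auto simp: int_step_def numeral_3_eq_3\<close>)
  moreover have "boundary k (\<lambda>i j. of_int (w i j))"
    unfolding w_def by (rule boundary_bump) (use assms lower_eq_upper[of k] in auto)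
  moreover have "w 2 2 < w (2 - 1) 2"
    using l by (simp add: w_def)
  ultimately show "\<exists>w. boundary k (\<lambda>i j. of_int (w i j)) \<and> w 2 2 < w (2 - 1) 2 \<and> steps_except k 2 2 w"
    by blast
  show "\<exists>s. corner_system k (\<lambda>i j. of_int (s i j)) \<and> s (2 - 1) 2 < s 2 2"
    using corner_system_upper[of k] assms by (intro exI[of _ upper]) (simp add: upper_def)
qed

section \<open>From witnesses at single positions to all facet equations\<close>

lemma row_zero_witness:
  assumes "4 \<le> k" "(i, j) \<in> row_zero_indices k"
  shows "\<exists>w. boundary k (\<lambda>i j. of_int (w i j)) \<and> w i j < w (i - 1) j \<and> steps_except k i j w"
    and "\<exists>s. corner_system k (\<lambda>i j. of_int (s i j)) \<and> s (i - 1) j < s i j"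
proof -
  consider "i = 2" "j = 2" | "3 \<le> i" "i \<le> k - 1" "2 \<le> j" "j \<le> k - 1 - of_bool (even i)"
    | "i = k" "3 \<le> j" "j \<le> k - 1" "odd j"
    using assms(2) unfolding row_zero_indices_def by auto
  then show "\<exists>w. boundary k (\<lambda>i j. of_int (w i j)) \<and> w i j < w (i - 1) j \<and> steps_except k i j w"
    "\<exists>s. corner_system k (\<lambda>i j. of_int (s i j)) \<and> s (i - 1) j < s i j"
    using corner_zero_witness[OF assms(1)] interior_zero_witness[of i k j] edge_zero_witness[of j k]
    by (cases; blast)+
qed

lemma row_one_witness:
  assumes "4 \<le> k" "(i, j) \<in> row_one_indices k"
  shows "\<exists>w. boundary k (\<lambda>i j. of_int (w i j)) \<and> w (i - 1) j + 1 < w i j \<and> steps_except k i j w"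
    and "\<exists>s. corner_system k (\<lambda>i j. of_int (s i j)) \<and> s i j < s (i - 1) j + 1"
proof -
  consider "4 \<le> i" "i \<le> k - 1" "4 \<le> j" "j \<le> k - 1 - of_bool (odd i)"
    | "i = k" "4 \<le> j" "j \<le> k - 1" "even j"
    using assms(2) unfolding row_one_indices_def by auto
  then show "\<exists>w. boundary k (\<lambda>i j. of_int (w i j)) \<and> w (i - 1) j + 1 < w i j \<and> steps_except k i j w"
    "\<exists>s. corner_system k (\<lambda>i j. of_int (s i j)) \<and> s i j < s (i - 1) j + 1"
    using interior_one_witness[of i k j] edge_one_witness[of j k]
    by (cases; blast)+
qed

lemma violated_only_by:
  assumes k: "4 \<le> k" and e: "Row_Eq i j c \<in> facet_equations k"
    and steps: "steps_except k i j w"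
    and viol: "rhs (Row_Eq i j c) < lhs (Row_Eq i j c) (\<lambda>x y. of_int (w x y))"
    and e': "e' \<in> facet_equations k" "e' \<noteq> Row_Eq i j c"
  shows "lhs e' (\<lambda>x y. of_int (w x y)) \<le> rhs e'"
proof (cases e')
  case (Row_Eq a b d)
  then have ab: "a \<in> {1..k}" "b \<in> {1..k}" "d = 0 \<or> d = 1"
    using Row_Eq_facet_equation_bounds[OF k] e'(1) by auto
  show ?thesis
  proof (cases "(a, b) = (i, j)")
    case True
    \<comment> \<open>Both bounds may be listed for the same position. A step that is negative is at
      most 1, and one that exceeds 1 is nonnegative, so violating one bound satisfies the
      other.\<close>
    then have "c \<noteq> d" using e'(2) Row_Eq by auto
    then show ?thesis
      using Row_Eq True viol ab Row_Eq_facet_equation_bounds[OF k e] by auto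
  next
    case False
    then have "unit_step (of_int (w (a - 1) b)) (of_int (w a b))"
      using steps ab by (auto simp: steps_except_def)
    then show ?thesis
      using Row_Eq ab(3) by (auto simp: unit_step_def)
  qed
next
  case (Col_Eq a b d)
  then have ab: "a \<in> {1..k}" "b \<in> {1..k}" "d = 0 \<or> d = 1" "(a, b) \<noteq> (2, 2)" "(a, b) \<noteq> (k - 1, k)"
    using Row_Eq_facet_equation_bounds[OF k] Col_Eq_facet_equations[OF k] e'(1) by blast+
  then have "unit_step (of_int (w a (b - 1))) (of_int (w a b))"
    using steps by (auto simp: steps_except_def)
  then show ?thesis
    using Col_Eq ab(3) by (auto simp: unit_step_def)
qed

definition only_violates :: "nat \<Rightarrow> equation \<Rightarrow> (nat \<Rightarrow> nat \<Rightarrow> real) \<Rightarrow> bool" where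
  "only_violates k e h \<longleftrightarrow> boundary k h \<and> rhs e < lhs e h \<and>
     (\<forall>e'\<in>facet_equations k - {e}. lhs e' h \<le> rhs e')"

lemma ex_only_violates_row:
  assumes k: "4 \<le> k" and e: "Row_Eq i j c \<in> facet_equations k"
  shows "\<exists>h. only_violates k (Row_Eq i j c) h"
    and "\<exists>h. corner_system k h \<and> lhs (Row_Eq i j c) h < rhs (Row_Eq i j c)"
proof -
  have "(\<exists>w. boundary k (\<lambda>i j. of_int (w i j)) \<and> steps_except k i j w \<and>
      rhs (Row_Eq i j c) < lhs (Row_Eq i j c) (\<lambda>x y. of_int (w x y))) \<and>
    (\<exists>s. corner_system k (\<lambda>i j. of_int (s i j)) \<and>
      lhs (Row_Eq i j c) (\<lambda>x y. of_int (s x y)) < rhs (Row_Eq i j c))"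
  proof (cases "c = 0")
    case True
    then have "(i, j) \<in> row_zero_indices k"
      using e by (simp add: Row_Eq_facet_equations)
    from row_zero_witness[OF k this] obtain w s
      where "boundary k (\<lambda>i j. of_int (w i j))" "w i j < w (i - 1) j" "steps_except k i j w"
        "corner_system k (\<lambda>i j. of_int (s i j))" "s (i - 1) j < s i j"
      by blast
    then show ?thesis
      using True by (intro conjI exI[of _ w] exI[of _ s]) simp_all
  next
    case False
    then have c: "c = 1" "(i, j) \<in> row_one_indices k"
      using e by (auto simp: Row_Eq_facet_equations)
    from row_one_witness[OF k c(2)] obtain w s
      where ws: "boundary k (\<lambda>i j. of_int (w i j))" "w (i - 1) j + 1 < w i j" "steps_except k i j w"
        "corner_system k (\<lambda>i j. of_int (s i j))" "s i j < s (i - 1) j + 1"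
      by blast
    have "real_of_int (w (i - 1) j) + 1 < real_of_int (w i j)"
      "real_of_int (s i j) < real_of_int (s (i - 1) j) + 1"
      using ws(2,5) by linarith+
    then show ?thesis
      using ws c by (intro conjI exI[of _ w] exI[of _ s]) simp_all
  qed
  then show "\<exists>h. only_violates k (Row_Eq i j c) h"
    "\<exists>h. corner_system k h \<and> lhs (Row_Eq i j c) h < rhs (Row_Eq i j c)"
    using violated_only_by[OF k e] unfolding only_violates_def by blast+
qed

lemma only_violates_flip:
  assumes k: "4 \<le> k" and e: "e \<in> facet_equations k" "flip e \<in> facet_equations k"
    and h: "only_violates k (flip e) h"
  shows "only_violates k e (\<lambda>i j. h j i)"
proof -
  have bd: "boundary k h" and ineq: "\<And>e'. e' \<in> facet_equations k \<Longrightarrow> e' \<noteq> flip e \<Longrightarrow> lhs e' h \<le> rhs e'"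
    using h by (auto simp: only_violates_def)
  have "lhs (flip e') h \<le> rhs e'" if e': "e' \<in> facet_equations k" "e' \<noteq> e" for e'
  proof (cases "flip e' \<in> facet_equations k")
    case True
    moreover have "flip e' \<noteq> flip e"
      using e'(2) by (metis flip_flip)
    ultimately show ?thesis
      using ineq[of "flip e'"] by simp
  next
    \<comment> \<open>Here \<open>e'\<close> is one of the two equations without a listed transpose.
      It takes the same value on \<open>h\<close> as its own flip, and \<open>h\<close> satisfies it
      because it differs from \<open>flip e\<close>.\<close>
    case False
    then have "e' \<noteq> flip e" using e(1) by auto
    then show ?thesis
      using ineq[OF e'(1)] flip_not_facet_equation[OF k e'(1) False bd] by simp
  qed
  moreover have "rhs e < lhs (flip e) h"
    using h by (simp add: only_violates_def)
  ultimately show ?thesis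
    using boundary_transpose[OF bd] lhs_flip[of _ h] by (simp add: only_violates_def)
qed

lemma ex_only_violates:
  assumes k: "4 \<le> k" and e: "e \<in> facet_equations k"
  shows "\<exists>h. only_violates k e h" and "\<exists>h. corner_system k h \<and> lhs e h < rhs e"
proof -
  have "(\<exists>h. only_violates k e h) \<and> (\<exists>h. corner_system k h \<and> lhs e h < rhs e)"
  proof (cases e)
    case (Row_Eq i j c)
    then show ?thesis using ex_only_violates_row[OF k] e by blast
  next
    case (Col_Eq i j c)
    then have flip: "flip e \<in> facet_equations k" "flip e = Row_Eq j i c"
      using e Col_Eq_facet_equations[OF k] by auto
    then obtain h s where "only_violates k (flip e) h" "corner_system k s" "lhs (flip e) s < rhs (flip e)"
      using ex_only_violates_row[OF k, of j i c] by metis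
    then have "only_violates k e (\<lambda>i j. h j i)" "corner_system k (\<lambda>i j. s j i)"
      "lhs e (\<lambda>i j. s j i) < rhs e"
      using only_violates_flip[OF k e flip(1)] corner_system_transpose[of k s] lhs_flip[of e s] by simp_all
    then show ?thesis by blast
  qed
  then show "\<exists>h. only_violates k e h" "\<exists>h. corner_system k h \<and> lhs e h < rhs e" by blast+
qed

section \<open>The number of facet equations\<close>

lemma card_swapped_Sigma:
  "card {(i, j). j \<in> A \<and> i \<in> B j} = card (Sigma A B)"
proof -
  have "{(i, j). j \<in> A \<and> i \<in> B j} = prod.swap ` Sigma A B"
    by (auto simp: image_iff)
  then show ?thesis
    by (simp add: card_image)
qed

text \<open>The parity counts \<open>Ev\<close> and \<open>Od\<close> almost cancel: what the
  shortened interior ranges lose, the last row and column restore. Only the last column stopping at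
  k - 2, unlike the last row, leaves a trace.\<close>

lemma card_facet_equations:
  assumes k: "4 \<le> k"
  shows "finite (facet_equations k)"
    and "int (card (facet_equations k)) = 4 * (int k)\<^sup>2 - 26 * int k + 46"
proof -
  define Ev where "Ev b = int (card {j \<in> {4..b}. even j})" for b :: nat
  define Od where "Od b = int (card {j \<in> {3..b}. odd j})" for b :: nat
  have ev: "(\<Sum>i=3..k - 1. of_bool (even i)) = Ev (k - 1)"
  proof -
    have "{3..k - 1} \<inter> {i. even i} = {j \<in> {4..k - 1}. even j}"
      by (auto simp: le_eq_less_or_eq[of 3])
    then show ?thesis by (simp add: Ev_def sum_of_bool_eq)
  qed
  \<comment> \<open>\<open>Od\<close> counts from 3 but the sum starts at 4, hence the correction by
    1.\<close>
  have od: "(\<Sum>i=4..k - 1. of_bool (odd i)) = Od (k - 1) - 1"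
  proof -
    have "{j \<in> {3..k - 1}. odd j} = insert 3 ({4..k - 1} \<inter> {i. odd i})"
      using k by (auto simp: le_eq_less_or_eq[of 3])
    then show ?thesis by (simp add: Od_def sum_of_bool_eq)
  qed
  \<comment> \<open>The index k - 1 is counted exactly once, as an even or as an odd number.\<close>
  have last: "Ev (k - 1) - Ev (k - 2) + (Od (k - 1) - Od (k - 2)) = 1"
  proof -
    obtain m where m: "k = m + 4" using k by (metis le_Suc_ex add.commute)
    have k1: "k - 1 = m + 3" "k - 2 = m + 2" using m by auto
    show ?thesis
    proof (cases "even m")
      case True
      then have sets: "{j \<in> {4..m + 3}. even j} = {j \<in> {4..m + 2}. even j}"
        "{j \<in> {3..m + 3}. odd j} = insert (m + 3) {j \<in> {3..m + 2}. odd j}"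
        by (auto; presburger)+
      show ?thesis unfolding Ev_def Od_def k1 sets by simp
    next
      case False
      then have sets: "{j \<in> {4..m + 3}. even j} = insert (m + 3) {j \<in> {4..m + 2}. even j}"
        "{j \<in> {3..m + 3}. odd j} = {j \<in> {3..m + 2}. odd j}"
        by (auto; presburger)+
      show ?thesis unfolding Ev_def Od_def k1 sets by simp
    qed
  qed
  let ?A = "SIGMA i:{3..k - 1}. {2..k - 1 - of_bool (even i)}"
  let ?B = "SIGMA i:{4..k - 1}. {4..k - 1 - of_bool (odd i)}"
  have A: "int (card ?A) = (int k - 3) * (int k - 2) - Ev (k - 1)"
  proof -
    have "int (card ?A) = (\<Sum>i=3..k - 1. int k - 2 - of_bool (even i))"
      unfolding card_SigmaI[OF finite_atLeastAtMost ballI[OF finite_atLeastAtMost]] of_nat_sum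
      by (rule sum.cong) (use k in \<open>auto simp: of_nat_diff\<close>)
    also have "\<dots> = (int k - 3) * (int k - 2) - Ev (k - 1)"
      unfolding sum_subtractf ev using k by (simp add: of_nat_diff algebra_simps)
    finally show ?thesis .
  qed
  have B: "int (card ?B) = (int k - 4) * (int k - 4) - (Od (k - 1) - 1)"
  proof -
    have "int (card ?B) = (\<Sum>i=4..k - 1. int k - 4 - of_bool (odd i))"
      unfolding card_SigmaI[OF finite_atLeastAtMost ballI[OF finite_atLeastAtMost]] of_nat_sum
      by (rule sum.cong) (use k in \<open>auto simp: of_nat_diff\<close>)
    also have "\<dots> = (int k - 4) * (int k - 4) - (Od (k - 1) - 1)"
      unfolding sum_subtractf od using k by (simp add: of_nat_diff algebra_simps)
    finally show ?thesis .
  qed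
  have rz: "row_zero_indices k = insert (2, 2) (?A \<union> {k} \<times> {j \<in> {3..k - 1}. odd j})"
    by (auto simp: row_zero_indices_def)
  have ro: "row_one_indices k = ?B \<union> {k} \<times> {j \<in> {4..k - 1}. even j}"
    by (auto simp: row_one_indices_def)
  have fin: "finite ?A" "finite ?B" by auto
  let ?A' = "{(i, j). j \<in> {3..k - 1} \<and> i \<in> {2..k - 1 - of_bool (even j)}}"
  let ?B' = "{(i, j). j \<in> {4..k - 1} \<and> i \<in> {4..k - 1 - of_bool (odd j)}}"
  have swap: "card ?A' = card ?A" "card ?B' = card ?B"
    by (simp_all only: card_swapped_Sigma[of "{3..k - 1}" "\<lambda>j. {2..k - 1 - of_bool (even j)}"]
      card_swapped_Sigma[of "{4..k - 1}" "\<lambda>j. {4..k - 1 - of_bool (odd j)}"])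
  have fin': "finite ?A'" "finite ?B'"
    by (rule finite_subset[of _ "{..k} \<times> {..k}"]; auto)+
  have finrz: "finite (row_zero_indices k)" and finro: "finite (row_one_indices k)"
    unfolding rz ro using fin by auto
  have fincz: "finite (col_zero_indices k)" and finco: "finite (col_one_indices k)"
    unfolding col_zero_indices_def col_one_indices_def using fin' by auto
  have cz: "int (card (row_zero_indices k)) = 1 + ((int k - 3) * (int k - 2) - Ev (k - 1)) + Od (k - 1)"
  proof -
    have "card (row_zero_indices k) = Suc (card (?A \<union> {k} \<times> {j \<in> {3..k - 1}. odd j}))"
      unfolding rz using fin k by (subst card_insert_disjoint) auto
    also have "card (?A \<union> {k} \<times> {j \<in> {3..k - 1}. odd j}) = card ?A + card ({k} \<times> {j \<in> {3..k - 1}. odd j})"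
      using fin k by (intro card_Un_disjoint) auto
    finally show ?thesis
      using A by (simp add: Od_def card_cartesian_product)
  qed
  have co: "int (card (row_one_indices k)) = (int k - 4) * (int k - 4) - (Od (k - 1) - 1) + Ev (k - 1)"
  proof -
    have "card (row_one_indices k) = card ?B + card ({k} \<times> {j \<in> {4..k - 1}. even j})"
      unfolding ro using fin k by (intro card_Un_disjoint) auto
    then show ?thesis
      using B by (simp add: Ev_def card_cartesian_product)
  qed
  have cz': "int (card (col_zero_indices k)) = (int k - 3) * (int k - 2) - Ev (k - 1) + Od (k - 2)"
  proof -
    have "card (col_zero_indices k) = card ?A' + card ({i \<in> {3..k - 2}. odd i} \<times> {k})"
      unfolding col_zero_indices_def using fin' k by (intro card_Un_disjoint) auto
    then show ?thesis
      using A unfolding swap by (simp add: Od_def card_cartesian_product)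
  qed
  have co': "int (card (col_one_indices k)) = (int k - 4) * (int k - 4) - (Od (k - 1) - 1) + Ev (k - 2)"
  proof -
    have "card (col_one_indices k) = card ?B' + card ({i \<in> {4..k - 2}. even i} \<times> {k})"
      unfolding col_one_indices_def using fin' k by (intro card_Un_disjoint) auto
    then show ?thesis
      using B unfolding swap by (simp add: Ev_def card_cartesian_product)
  qed
  let ?R = "\<lambda>c (i, j). Row_Eq i j c" and ?C = "\<lambda>c (i, j). Col_Eq i j c"
  have eq: "facet_equations k = ?R 0 ` row_zero_indices k \<union> ?R 1 ` row_one_indices k
      \<union> ?C 0 ` col_zero_indices k \<union> ?C 1 ` col_one_indices k"
    by (auto simp: facet_equations_def image_iff)
  show "finite (facet_equations k)"
    unfolding eq using finrz finro fincz finco by simp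
  have inj: "inj_on (?R c) S" "inj_on (?C c) S" for c S
    by (auto simp: inj_on_def)
  have "card (facet_equations k) = card (row_zero_indices k) + card (row_one_indices k)
      + card (col_zero_indices k) + card (col_one_indices k)"
    unfolding eq using finrz finro fincz finco
    by (subst card_Un_disjoint; (auto simp: card_image[OF inj(1)] card_image[OF inj(2)])[1])+
  then have "int (card (facet_equations k)) = 2 * ((int k - 3) * (int k - 2)) + 2 * ((int k - 4) * (int k - 4)) + 3
      - (Ev (k - 1) - Ev (k - 2) + (Od (k - 1) - Od (k - 2)))"
    using cz co cz' co' by simp
  then show "int (card (facet_equations k)) = 4 * (int k)\<^sup>2 - 26 * int k + 46"
    unfolding last by (simp add: power2_eq_square algebra_simps)
qed

section \<open>The facets of the core polytope\<close>

lemma linear_lhs_corner: "linear (\<lambda>Y. lhs e (corner idx Y))"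
  by (cases e; rule linearI) (simp_all add: corner_add corner_scaleR algebra_simps)

lemma affine_boundary_corner: "affine {Y. boundary k (corner idx Y)}"
proof -
  have "corner idx (u *\<^sub>R x + v *\<^sub>R y) = (\<lambda>i j. u * corner idx x i j + v * corner idx y i j)" for x y u v
    by (intro ext) (simp add: corner_add corner_scaleR)
  then show ?thesis
    unfolding affine_def by (simp add: boundary_affine)
qed

lemma satisfies_iff_tight:
  assumes "4 \<le> k" "e \<in> facet_equations k"
  shows "satisfies idx Y e \<longleftrightarrow> lhs e (corner idx Y) = rhs e"
  by (cases rule: facet_equation_cases[OF assms]) (auto simp: row_sum_corner col_sum_corner)

lemma lhs_corner_of_corner:
  assumes "4 \<le> k" "e \<in> facet_equations k" "inj_on idx {1..k}" "boundary k h"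
  shows "lhs e (corner idx (of_corner idx k h)) = lhs e h"
proof -
  have c: "corner idx (of_corner idx k h) i j = h i j" if "i \<le> k" "j \<le> k" for i j
    using that assms(4) by (intro corner_of_corner[OF assms(3)]) (auto simp: boundary_def)
  show ?thesis
    by (cases rule: facet_equation_cases[OF assms(1,2)]) (auto simp: c)
qed

theorem theorem4p7:
  fixes n k :: nat and idx :: "nat \<Rightarrow> 'k::finite"
  assumes "n \<ge> 9" and "odd n" and "k = n div 2"
    and "bij_betw idx {1..k} (UNIV :: 'k set)"
  shows "bij_betw (core_face idx n) (facet_equations k) {F. F facet_of core_polytope idx n}
    \<and> int (card {F. F facet_of core_polytope idx n}) = (int n)\<^sup>2 - 15 * int n + 60"
proof -
  let ?E = "facet_equations k" and ?P = "core_polytope idx n"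
  let ?f = "\<lambda>e Y. lhs e (corner idx Y)" and ?A = "{Y. boundary k (corner idx Y)}"
  have k: "4 \<le> k" and n: "n = 2 * k + 1"
    using assms(1-3) by presburger+
  have inj: "inj_on idx {1..k}"
    using assms(4) by (rule bij_betw_imp_inj_on)
  have P: "?P = {Y. corner_system k (corner idx Y)}"
    unfolding n using core_polytope_eq[OF assms(4)] k by simp
  have bij: "bij_betw (\<lambda>e. {Y\<in>?P. ?f e Y = rhs e}) ?E {F. F facet_of ?P}"
  proof (rule bij_betw_facets)
    show "finite ?E" by (rule card_facet_equations(1)[OF k])
    show "affine ?A" by (rule affine_boundary_corner)
    show "linear (?f e)" for e by (rule linear_lhs_corner)
    show "?P = {Y\<in>?A. \<forall>e\<in>?E. ?f e Y \<le> rhs e}"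
      unfolding P corner_system_iff_facet_inequalities[OF k] facet_inequalities_def by simp
    show "?E \<noteq> {}"
      by (auto simp: facet_equations_def row_zero_indices_def)
    fix e assume e: "e \<in> ?E"
    obtain h where h: "corner_system k h" "lhs e h < rhs e"
      using ex_only_violates(2)[OF k e] by blast
    then have "of_corner idx k h \<in> ?P" "?f e (of_corner idx k h) < rhs e"
      using corner_system_of_corner[OF inj h(1)] lhs_corner_of_corner[OF k e inj, of h] k
      by (simp_all add: P corner_system_def)
    then show "\<exists>s\<in>?P. ?f e s < rhs e" by blast
    obtain h where h: "boundary k h" "rhs e < lhs e h" "\<And>e'. e' \<in> ?E - {e} \<Longrightarrow> lhs e' h \<le> rhs e'"
      using ex_only_violates(1)[OF k e] unfolding only_violates_def by blast
    have "of_corner idx k h \<in> ?A"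
      using boundary_of_corner[OF inj h(1)] k by simp
    moreover have "?f e' (of_corner idx k h) = lhs e' h" if "e' \<in> ?E" for e'
      by (rule lhs_corner_of_corner[OF k that inj h(1)])
    ultimately show "\<exists>w\<in>?A. rhs e < ?f e w \<and> (\<forall>e'\<in>?E - {e}. ?f e' w \<le> rhs e')"
      using h(2,3) e by (intro bexI[of _ "of_corner idx k h"]) auto
  qed
  have eq: "core_face idx n e = {Y\<in>?P. ?f e Y = rhs e}" if "e \<in> ?E" for e
    unfolding core_face_def using satisfies_iff_tight[OF k that] by blast
  have face: "bij_betw (core_face idx n) ?E {F. F facet_of ?P}"
    by (rule iffD2[OF bij_betw_cong bij]) (rule eq)
  have "int (card {F. F facet_of ?P}) = 4 * (int k)\<^sup>2 - 26 * int k + 46"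
    using bij_betw_same_card[OF face] card_facet_equations(2)[OF k] by simp
  \<comment> \<open>Substituting n = 2k + 1 turns n*n - 15n + 60 into 4k*k - 26k + 46.\<close>
  then have "int (card {F. F facet_of ?P}) = (int n)\<^sup>2 - 15 * int n + 60"
    unfolding n by (simp add: power2_eq_square algebra_simps)
  with face show ?thesis by blast
qed

end
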